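(* Let $\varepsilon>0$ and let $\rho_\varepsilon:\mathbb{R}^d\to[0,\infty]$ be a measurable kernel whose essential support is $\overline{B_\varepsilon(0)}$. Let $\mathcal{B}_{W^{\rho_\varepsilon,1}}:=\{u\in W^{\rho_\varepsilon,1}(\mathbb{R}^d): |u|_{W^{\rho_\varepsilon,1}(\mathbb{R}^d)}\le1\}$. Then the set of its extreme points is $$\operatorname{Ext}(\mathcal{B}_{W^{\rho_\varepsilon,1}})=\left\{\pm\frac{\mathbf{1}_E}{\mathbb{P}_\varepsilon(E)}\ \middle|\ E\subset\mathbb{R}^d\text{ with }|E|\in(0,\infty),\ \mathbb{P}_\varepsilon(E)\in(0,\infty)\text{ and }E\ \varepsilon\text{-simple}\right\}.$$
   Context: $|u|_{W^{\rho_\varepsilon,1}(\mathbb{R}^d)}:=\int_{\mathbb{R}^d}\int_{\mathbb{R}^d}\frac{|u(x)-u(y)|}{|x-y|}\rho_\varepsilon(x-y)\,dx\,dy$, and $W^{\rho_\varepsilon,1}(\mathbb{R}^d)$ is the space of $u\in L^1(\mathbb{R}^d)$ for which this is finite (functions identified a.e.). For measurable $E$, $\mathbb{P}_\varepsilon(E):=|\mathbf{1}_E|_{W^{\rho_\varepsilon,1}(\mathbb{R}^d)}$ (the same double integral is used also if $|E|=\infty$). A set $E$ with $\mathbb{P}_\varepsilon(E)<\infty$ is $\varepsilon$-decomposable if there is a partition $\{E_1,E_2\}$ of $E$ into sets of finite $\mathbb{P}_\varepsilon$-perimeter with $|E_1|,|E_2|>0$ and $\mathbb{P}_\varepsilon(E)=\mathbb{P}_\varepsilon(E_1)+\mathbb{P}_\varepsilon(E_2)$;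 otherwise it is $\varepsilon$-indecomposable. For measurable $F$, $F^{(1)}:=\{x:\lim_{r\to0}|F\cap B_r(x)|/|B_r(x)|=1\}$; $x,y\in F^{(1)}$ are $\varepsilon$-connected in $F$ if there are $z_0=x,z_1,\dots,z_N=y$ in $F^{(1)}$ with $|z_i-z_{i+1}|<\varepsilon$ for all $i$; the $\varepsilon$-connected component of $F$ containing $x\in F^{(1)}$ is the set of $y\in F^{(1)}$ that are $\varepsilon$-connected to $x$ in $F$. A set $E\subset\mathbb{R}^d$ with $|E|<\infty$ is $\varepsilon$-simple if $E$ is $\varepsilon$-indecomposable and $E^c$ has no $\varepsilon$-connected component with finite measure. The essential support of $\rho_\varepsilon$ is the smallest closed set outside of which $\rho_\varepsilon=0$ a.e.
   Formalization: The formal theorem additionally assumes that W^{ρ_ε,1}(R^d) is not {0}; otherwise (e.g. ρ_ε = ∞ on the closed ε-ball, 0 outside) the unit ball is {0}, its only extreme point is 0, and the right-hand set is empty. *)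

theory Defs
  imports "HOL-Analysis.Analysis"
begin

text \<open>Integrable real functions on a Euclidean space, identified almost everywhere.\<close>

definition L1_rel :: "('a::euclidean_space \<Rightarrow> real) \<Rightarrow> ('a \<Rightarrow> real) \<Rightarrow> bool" where
  "L1_rel f g \<longleftrightarrow> integrable lebesgue f \<and> integrable lebesgue g \<and> (AE x in lebesgue. f x = g x)"

lemma part_equivp_L1_rel: "part_equivp (L1_rel :: ('a::euclidean_space \<Rightarrow> real) \<Rightarrow> _)"
proof (rule part_equivpI)
  have "L1_rel (\<lambda>x::'a. 0) (\<lambda>x. 0)"
    by (simp add: L1_rel_def)
  then show "\<exists>f::'a \<Rightarrow> real. L1_rel f f" by blast
  show "symp (L1_rel :: ('a \<Rightarrow> real) \<Rightarrow> _)"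
    by (auto simp: symp_def L1_rel_def eq_commute)
  show "transp (L1_rel :: ('a \<Rightarrow> real) \<Rightarrow> _)"
    unfolding transp_def L1_rel_def by (auto elim: AE_mp)
qed

quotient_type (overloaded) 'a L1 = "'a::euclidean_space \<Rightarrow> real" / partial: L1_rel
  by (rule part_equivp_L1_rel)

instantiation L1 :: (euclidean_space) real_vector
begin

lift_definition zero_L1 :: "'a L1" is "\<lambda>x. 0"
  by (simp add: L1_rel_def)

lift_definition plus_L1 :: "'a L1 \<Rightarrow> 'a L1 \<Rightarrow> 'a L1" is "\<lambda>f g x. f x + g x"
  by (auto simp: L1_rel_def elim: AE_mp)

lift_definition minus_L1 :: "'a L1 \<Rightarrow> 'a L1 \<Rightarrow> 'a L1" is "\<lambda>f g x. f x - g x"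
  by (auto simp: L1_rel_def elim: AE_mp)

lift_definition uminus_L1 :: "'a L1 \<Rightarrow> 'a L1" is "\<lambda>f x. - f x"
  by (auto simp: L1_rel_def elim: AE_mp)

lift_definition scaleR_L1 :: "real \<Rightarrow> 'a L1 \<Rightarrow> 'a L1" is "\<lambda>c f x. c * f x"
  by (auto simp: L1_rel_def elim: AE_mp)

instance
  by standard (transfer, auto simp: L1_rel_def algebra_simps)+

end

text \<open>The class of an integrable function is \<open>abs_L1 f\<close>; it is unspecified if \<open>f\<close> is not integrable.\<close>

text \<open>
  At \<open>x = y\<close> the integrand is \<open>0\<close>, because \<open>0 / 0 = 0\<close> in \<open>real\<close> and \<open>0 * \<infinity> = 0\<close> in \<open>ennreal\<close>.
\<close>

definition seminorm_fun :: "('a::euclidean_space \<Rightarrow> ennreal) \<Rightarrow> ('a \<Rightarrow> real) \<Rightarrow> ennreal" where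
  "seminorm_fun \<rho> u =
    (\<integral>\<^sup>+y. (\<integral>\<^sup>+x. ennreal (\<bar>u x - u y\<bar> / norm (x - y)) * \<rho> (x - y) \<partial>lebesgue) \<partial>lebesgue)"

lift_definition seminorm_L1 :: "('a::euclidean_space \<Rightarrow> ennreal) \<Rightarrow> 'a L1 \<Rightarrow> ennreal"
  is seminorm_fun
proof -
  fix \<rho> :: "'a \<Rightarrow> ennreal" and f g :: "'a \<Rightarrow> real"
  assume "L1_rel f g"
  then have ae: "AE x in lebesgue. f x = g x"
    by (simp add: L1_rel_def)
  show "seminorm_fun \<rho> f = seminorm_fun \<rho> g"
    unfolding seminorm_fun_def
  proof (rule nn_integral_cong_AE, use ae in eventually_elim, rule nn_integral_cong_AE)
    fix y assume "f y = g y"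
    with ae show "AE x in lebesgue. ennreal (\<bar>f x - f y\<bar> / norm (x - y)) * \<rho> (x - y) =
        ennreal (\<bar>g x - g y\<bar> / norm (x - y)) * \<rho> (x - y)"
      by (auto elim: AE_mp)
  qed
qed

definition W_space :: "('a::euclidean_space \<Rightarrow> ennreal) \<Rightarrow> 'a L1 set" where
  "W_space \<rho> = {u. seminorm_L1 \<rho> u < \<infinity>}"

text \<open>
  \<open>W_space \<rho>\<close> may be trivial: for a kernel that is \<open>\<infinity>\<close> on \<open>cball 0 \<epsilon>\<close>, an integrable function of
  finite seminorm is locally constant almost everywhere, hence \<open>0\<close>.  Then the only extreme point
  of the unit ball is \<open>0\<close>, and no set of finite positive measure has finite perimeter.  A
  description of the extreme points by sets therefore needs \<open>W_space \<rho> \<noteq> {0}\<close>.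
\<close>

definition W_unit_ball :: "('a::euclidean_space \<Rightarrow> ennreal) \<Rightarrow> 'a L1 set" where
  "W_unit_ball \<rho> = {u \<in> W_space \<rho>. seminorm_L1 \<rho> u \<le> 1}"

definition perimeter :: "('a::euclidean_space \<Rightarrow> ennreal) \<Rightarrow> 'a set \<Rightarrow> ennreal" where
  "perimeter \<rho> E = seminorm_fun \<rho> (indicat_real E)"

definition decomposable :: "('a::euclidean_space \<Rightarrow> ennreal) \<Rightarrow> 'a set \<Rightarrow> bool" where
  "decomposable \<rho> E \<longleftrightarrow>
    E \<in> sets lebesgue \<and> perimeter \<rho> E < \<infinity> \<and>
    (\<exists>E1 E2. E1 \<in> sets lebesgue \<and> E2 \<in> sets lebesgue \<and>
      E1 \<union> E2 = E \<and> E1 \<inter> E2 = {} \<and>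
      perimeter \<rho> E1 < \<infinity> \<and> perimeter \<rho> E2 < \<infinity> \<and>
      emeasure lebesgue E1 > 0 \<and> emeasure lebesgue E2 > 0 \<and>
      perimeter \<rho> E = perimeter \<rho> E1 + perimeter \<rho> E2)"

definition indecomposable :: "('a::euclidean_space \<Rightarrow> ennreal) \<Rightarrow> 'a set \<Rightarrow> bool" where
  "indecomposable \<rho> E \<longleftrightarrow>
    E \<in> sets lebesgue \<and> perimeter \<rho> E < \<infinity> \<and> \<not> decomposable \<rho> E"

definition density_points :: "'a::euclidean_space set \<Rightarrow> 'a set" where
  "density_points F =
    {x. ((\<lambda>r. measure lebesgue (F \<inter> ball x r) / measure lebesgue (ball x r)) \<longlongrightarrow> 1) (at_right 0)}"

definition eps_connected :: "real \<Rightarrow> 'a::euclidean_space set \<Rightarrow> 'a \<Rightarrow> 'a \<Rightarrow> bool" where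
  "eps_connected \<epsilon> F x y \<longleftrightarrow>
    (\<exists>(N::nat) z. z 0 = x \<and> z N = y \<and> (\<forall>i\<le>N. z i \<in> density_points F) \<and>
      (\<forall>i<N. norm (z i - z (Suc i)) < \<epsilon>))"

definition eps_component :: "real \<Rightarrow> 'a::euclidean_space set \<Rightarrow> 'a \<Rightarrow> 'a set" where
  "eps_component \<epsilon> F x = {y \<in> density_points F. eps_connected \<epsilon> F x y}"

text \<open>
  For measurable \<open>F\<close> the components are measurable: each is the intersection of
  \<open>density_points F\<close> with an open set. So \<open>emeasure\<close> below is their Lebesgue measure.
\<close>

definition simple_set :: "real \<Rightarrow> ('a::euclidean_space \<Rightarrow> ennreal) \<Rightarrow> 'a set \<Rightarrow> bool" where
  "simple_set \<epsilon> \<rho> E \<longleftrightarrow>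
    emeasure lebesgue E < \<infinity> \<and> indecomposable \<rho> E \<and>
    \<not> (\<exists>x \<in> density_points (- E). emeasure lebesgue (eps_component \<epsilon> (- E) x) < \<infinity>)"

definition is_ess_support :: "('a::euclidean_space \<Rightarrow> ennreal) \<Rightarrow> 'a set \<Rightarrow> bool" where
  "is_ess_support \<rho> K \<longleftrightarrow>
    closed K \<and> (AE x in lebesgue. x \<notin> K \<longrightarrow> \<rho> x = 0) \<and>
    (\<forall>C. closed C \<and> (AE x in lebesgue. x \<notin> C \<longrightarrow> \<rho> x = 0) \<longrightarrow> K \<subseteq> C)"

end

theory Submission
  imports Defs
begin

text \<open>
  Write \<open>k z = \<rho> z / norm z\<close>, so that the seminorm of \<open>u\<close> is the integral of \<open>\<bar>u x - u y\<bar>\<close> against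
  the measure \<open>interaction \<rho>\<close> with density \<open>k (x - y)\<close> on pairs of points.  The unit ball of the
  theorem is the unit ball of this seminorm, which turns out to be a norm.

  The hypothesis on the support says that points at distance \<open>\<epsilon>\<close> or more do not interact, and it gives
  a converse, \<open>AE_near_rectangle\<close>, on which the proof rests: if the product of two Borel sets is null for \<open>interaction \<rho>\<close>, then almost no pair in it has distance less than \<open>\<epsilon>\<close>.
  The kernel itself may vanish on large parts of the ball, but the measure of \<open>A \<inter> (B + z)\<close> is
  positive for an open set of \<open>z\<close> by Steinhaus, and \<open>\<rho>\<close> does not vanish almost everywhere on a
  nonempty open part of the ball.  Consequently a set \<open>F\<close> that splits into two non-interacting parts
  splits along its \<open>\<epsilon>\<close>-components, and an integrable function that is constant across interacting
  pairs in \<open>F\<close> vanishes on \<open>F\<close> as soon as every \<open>\<epsilon>\<close>-component of \<open>F\<close> has infinite measure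
  (\<open>AE_zero_if_locally_constant\<close>).  With \<open>F = UNIV\<close> this makes the seminorm definite.

  \<^emph>\<open>Extreme points are simple.\<close>  An extreme point \<open>u\<close> has norm \<open>1\<close>, and whenever \<open>u = v + w\<close> with norms
  that add up, both summands are multiples of \<open>u\<close> (\<open>extreme_split\<close>).  Norms add up in the following
  decompositions.  Clipping the values of \<open>u\<close> to an interval containing \<open>0\<close> leaves a remainder that
  is a monotone function of \<open>u\<close> as well; so all clippings of \<open>u\<close> are proportional to \<open>u\<close>, and \<open>u\<close> has only
  one nonzero value, \<open>u = c 1\<^sub>E\<close>.  If \<open>E\<close> decomposes into two parts, then
  \<open>u\<close> is the sum of \<open>c\<close> times their indicator functions.  If \<open>C\<close> is a component of the complement
  with finite measure, then
  \<open>u\<close> is \<open>c\<close> times the indicator function of \<open>E \<union> C\<close> minus \<open>c 1\<^sub>C\<close>, and the norms add up because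
  \<open>C\<close> interacts with \<open>E\<close> only.  Both contradict proportionality.

  \<^emph>\<open>Simple sets are extreme.\<close>  If \<open>c 1\<^sub>E\<close> has norm \<open>1\<close> and lies strictly between \<open>a\<close> and \<open>b\<close> in the
  unit ball, then equality holds in the triangle inequality, hence in its integrand.  So \<open>a\<close> and \<open>b\<close> are
  constant across interacting pairs inside \<open>E\<close> and inside the complement.  Indecomposability
  makes them constant on \<open>E\<close>, and the components of the complement, all of infinite measure, make
  them \<open>0\<close> outside (\<open>simple_rigidity\<close>).  Thus \<open>a\<close> and \<open>b\<close> are multiples of \<open>1\<^sub>E\<close> of norm at
  most \<open>1\<close> with a convex combination of norm \<open>1\<close>, which forces \<open>a = b\<close>.
\<close>

section \<open>Lebesgue density points\<close>

text \<open>
  Take an open \<open>G \<supseteq> F\<close> with \<open>G - F\<close> of measure at most \<open>e * \<eta>\<close>.  By Vitali's theorem, disjoint balls in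
  \<open>G\<close> that violate the density bound cover the set up to a negligible remainder.  Each has measure less than
  that of its part outside \<open>F\<close> divided by \<open>e\<close>, so their total measure is at most \<open>\<eta>\<close>.
\<close>

lemma negligible_upper_density_complement:
  fixes F :: "'a::euclidean_space set"
  assumes F: "F \<in> sets lebesgue" and e: "0 < e"
  shows "negligible {x \<in> F. \<forall>\<delta>>0. \<exists>r. 0 < r \<and> r < \<delta> \<and>
    e * measure lebesgue (ball x r) < measure lebesgue (ball x r - F)}" (is "negligible ?N")
  unfolding negligible_outer_le
proof (intro allI impI)
  let ?\<mu> = "measure lebesgue"
  fix \<eta> :: real assume "\<eta> > 0"
  then have "e * \<eta> > 0" using e by simp
  then obtain G where G: "open G" "F \<subseteq> G" "G - F \<in> lmeasurable"
    "emeasure lebesgue (G - F) < ennreal (e * \<eta>)"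
    using sets_lebesgue_outer_open[OF F] by blast
  have GF: "?\<mu> (G - F) \<le> e * \<eta>"
    using G(3,4) \<open>e * \<eta> > 0\<close> by (simp add: emeasure_eq_measure2 ennreal_less_iff)
  let ?K = "{(x, r). x \<in> F \<and> 0 < r \<and> ball x r \<subseteq> G \<and> e * ?\<mu> (ball x r) < ?\<mu> (ball x r - F)}"
  (* balls inside G in which the complement of F takes more than the fraction e *)
  obtain C where C: "countable C" "C \<subseteq> ?K"
    and pw: "pairwise (\<lambda>i j. disjnt (ball (fst i) (snd i)) (ball (fst j) (snd j))) C"
    and neg: "negligible (?N - (\<Union>i\<in>C. ball (fst i) (snd i)))"
  proof (rule Vitali_covering_theorem_balls[of ?N ?K fst snd])
    fix x and d :: real assume x: "x \<in> ?N" and d: "0 < d"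
    then obtain k where k: "k > 0" "ball x k \<subseteq> G"
      using G(1,2) by (metis (no_types, lifting) mem_Collect_eq openE subsetD)
    moreover obtain r where r: "0 < r" "r < min d k" "e * ?\<mu> (ball x r) < ?\<mu> (ball x r - F)"
      using x d k(1) by (auto dest!: spec[of _ "min d k"])
    ultimately have "ball x r \<subseteq> G"
      using subset_ball[of r k x] by auto
    then show "\<exists>i. i \<in> ?K \<and> x \<in> ball (fst i) (snd i) \<and> snd i < d"
      using r x by (intro exI[of _ "(x, r)"]) auto
  qed
  let ?B = "\<lambda>i::'a \<times> real. ball (fst i) (snd i)"
  (* The parts of the balls outside F are disjoint and lie in G - F. *)
  have fin: "?\<mu> (\<Union>i\<in>I. ?B i) \<le> \<eta>" if I: "I \<subseteq> C" "finite I" for I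
  proof -
    have m: "?B i - F \<in> lmeasurable" for i
      by (rule fmeasurable_Diff) (auto simp: F)
    have "e * ?\<mu> (\<Union>i\<in>I. ?B i) \<le> e * (\<Sum>i\<in>I. ?\<mu> (?B i))"
      using e by (intro mult_left_mono measure_UNION_le \<open>finite I\<close>) auto
    also have "\<dots> \<le> (\<Sum>i\<in>I. ?\<mu> (?B i - F))"
      unfolding sum_distrib_left
    proof (rule sum_mono)
      fix i assume "i \<in> I"
      then have "i \<in> ?K" using I(1) C(2) by blast
      then show "e * ?\<mu> (?B i) \<le> ?\<mu> (?B i - F)" by (auto simp: case_prod_unfold)
    qed
    also have "\<dots> = ?\<mu> (\<Union>i\<in>I. ?B i - F)"
    proof (rule measure_UNION'[symmetric, OF \<open>finite I\<close> m])
      show "pairwise (\<lambda>i j. disjnt (?B i - F) (?B j - F)) I"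
        using pairwise_subset[OF pw I(1)] by (rule pairwise_mono) (auto simp: disjnt_def)
    qed
    also have "\<dots> \<le> ?\<mu> (G - F)"
    proof (rule measure_mono_fmeasurable[OF _ _ G(3)])
      show "(\<Union>i\<in>I. ?B i - F) \<subseteq> G - F" using I(1) C(2) by fastforce
      show "(\<Union>i\<in>I. ?B i - F) \<in> sets lebesgue"
        using m by (intro sets.finite_UN \<open>finite I\<close>) (auto dest: fmeasurableD)
    qed
    also note GF
    finally show ?thesis using e by simp
  qed
  have U: "(\<Union>i\<in>C. ?B i) \<in> lmeasurable" "?\<mu> (\<Union>i\<in>C. ?B i) \<le> \<eta>"
    using fin by (auto intro!: fmeasurable_UN_bound[OF C(1)] measure_UN_bound[OF C(1)])
  let ?T = "(?N - (\<Union>i\<in>C. ?B i)) \<union> (\<Union>i\<in>C. ?B i)"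
  have "?T \<in> lmeasurable"
    using U neg by (intro fmeasurable.Un) (auto simp: negligible_imp_measurable)
  moreover have "?\<mu> ?T \<le> \<eta>"
    using measure_Un_le[of "?N - (\<Union>i\<in>C. ?B i)" lebesgue "\<Union>i\<in>C. ?B i"] neg U
    by (simp add: negligible_imp_measure0 negligible_imp_sets fmeasurableD)
  moreover have "?N \<subseteq> ?T" by blast
  ultimately show "\<exists>T. ?N \<subseteq> T \<and> T \<in> lmeasurable \<and> ?\<mu> T \<le> \<eta>" by blast
qed

lemma density_pointI:
  fixes F :: "'a::euclidean_space set"
  assumes F: "F \<in> sets lebesgue"
    and small: "\<And>e. e > 0 \<Longrightarrow> \<exists>\<delta>>0. \<forall>r. 0 < r \<longrightarrow> r < \<delta> \<longrightarrow>
      measure lebesgue (ball x r - F) \<le> e * measure lebesgue (ball x r)"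
  shows "x \<in> density_points F"
  unfolding density_points_def mem_Collect_eq
proof (rule tendstoI)
  fix e :: real assume "e > 0"
  then obtain \<delta> where \<delta>: "\<delta> > 0" "\<And>r. 0 < r \<Longrightarrow> r < \<delta> \<Longrightarrow>
      measure lebesgue (ball x r - F) \<le> e / 2 * measure lebesgue (ball x r)"
    using small[of "e / 2"] by auto
  show "\<forall>\<^sub>F r in at_right 0. dist (measure lebesgue (F \<inter> ball x r) / measure lebesgue (ball x r)) 1 < e"
    unfolding eventually_at_right_field
  proof (rule exI[of _ \<delta>], safe)
    show "0 < \<delta>" by (rule \<delta>(1))
    fix r assume r: "0 < r" "r < \<delta>"
    let ?b = "measure lebesgue (ball x r)"
    have b: "?b > 0" using content_ball_pos[OF r(1), of x] by simp
    have "?b = measure lebesgue (F \<inter> ball x r) + measure lebesgue (ball x r - F)"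
    proof -
      have "F \<inter> ball x r \<union> ball x r = ball x r" "ball x r - F \<inter> ball x r = ball x r - F" by auto
      then show ?thesis
        using measure_Un2[of "F \<inter> ball x r" lebesgue "ball x r"] fmeasurable_Int_fmeasurable[OF _ F, of "ball x r"]
        by (simp add: Int_commute)
    qed
    then have "1 - measure lebesgue (F \<inter> ball x r) / ?b = measure lebesgue (ball x r - F) / ?b"
      using b by (simp add: field_simps)
    moreover have "measure lebesgue (ball x r - F) / ?b \<le> e / 2"
      using \<delta>(2)[OF r] b by (simp add: divide_le_eq)
    moreover have "measure lebesgue (ball x r - F) / ?b \<ge> 0" by simp
    ultimately show "dist (measure lebesgue (F \<inter> ball x r) / ?b) 1 < e"
      using \<open>e > 0\<close> unfolding dist_real_def by linarith
  qed
qed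

lemma AE_density_point:
  fixes F :: "'a::euclidean_space set"
  assumes F: "F \<in> sets lebesgue"
  shows "AE x in lebesgue. x \<in> F \<longrightarrow> x \<in> density_points F"
proof -
  define N where "N n = {x \<in> F. \<forall>\<delta>>0. \<exists>r. 0 < r \<and> r < \<delta> \<and>
    inverse (real (Suc n)) * measure lebesgue (ball x r) < measure lebesgue (ball x r - F)}" for n
  have "negligible (\<Union>n. N n)"
  proof (rule negligible_Union_nat)
    show "negligible (N n)" for n
      unfolding N_def by (rule negligible_upper_density_complement[OF F]) simp
  qed
  then have "AE x in lebesgue. x \<notin> (\<Union>n. N n)"
    unfolding negligible_iff_null_sets by (rule AE_not_in)
  then show ?thesis
  proof (eventually_elim, intro impI density_pointI[OF F])
    fix x and e :: real assume x: "x \<notin> (\<Union>n. N n)" "x \<in> F" and "e > 0"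
    then obtain n where n: "inverse (real (Suc n)) < e" using reals_Archimedean by blast
    from x obtain \<delta> where \<delta>: "\<delta> > 0" "\<And>r. 0 < r \<Longrightarrow> r < \<delta> \<Longrightarrow>
      measure lebesgue (ball x r - F) \<le> inverse (real (Suc n)) * measure lebesgue (ball x r)"
      unfolding N_def by (simp only: UN_iff mem_Collect_eq UNIV_I bex_simps not_less) (meson not_less)
    have "inverse (real (Suc n)) * measure lebesgue (ball x r) \<le> e * measure lebesgue (ball x r)" for r
      using n by (intro mult_right_mono) auto
    with \<delta> show "\<exists>\<delta>>0. \<forall>r. 0 < r \<longrightarrow> r < \<delta> \<longrightarrow>
      measure lebesgue (ball x r - F) \<le> e * measure lebesgue (ball x r)"
      by (meson order_trans)
  qed
qed

lemma density_points_Compl_disjoint: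
  fixes F :: "'a::euclidean_space set"
  assumes F: "F \<in> sets lebesgue"
  shows "density_points F \<inter> density_points (- F) = {}"
proof (rule ccontr)
  let ?m = "measure lebesgue"
  assume "\<not> ?thesis"
  then obtain x where "((\<lambda>r. ?m (F \<inter> ball x r) / ?m (ball x r)) \<longlongrightarrow> 1) (at_right 0)"
    "((\<lambda>r. ?m (- F \<inter> ball x r) / ?m (ball x r)) \<longlongrightarrow> 1) (at_right 0)"
    by (auto simp: density_points_def)
  from tendsto_add[OF this]
  have lim: "((\<lambda>r. ?m (F \<inter> ball x r) / ?m (ball x r) + ?m (- F \<inter> ball x r) / ?m (ball x r)) \<longlongrightarrow> 2) (at_right 0)"
    by simp
  have "?m (F \<inter> ball x r) / ?m (ball x r) + ?m (- F \<inter> ball x r) / ?m (ball x r) = 1" if "0 < r" for r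
  proof -
    have "?m (ball x r) = ?m (F \<inter> ball x r) + ?m (- F \<inter> ball x r)"
    proof -
      have *: "F \<inter> ball x r \<union> ball x r = ball x r" "ball x r - F \<inter> ball x r = - F \<inter> ball x r" by auto
      show ?thesis
        using measure_Un2[of "F \<inter> ball x r" lebesgue "ball x r"] fmeasurable_Int_fmeasurable[OF _ F, of "ball x r"]
        unfolding * by (simp add: Int_commute)
    qed
    moreover have "?m (ball x r) > 0" using content_ball_pos[OF that, of x] by simp
    ultimately show ?thesis by (metis add_divide_distrib divide_self less_irrefl)
  qed
  then have "\<forall>\<^sub>F r in at_right 0. ?m (F \<inter> ball x r) / ?m (ball x r) + ?m (- F \<inter> ball x r) / ?m (ball x r) = 1"
    by (auto simp: eventually_at_right_field intro: exI[of _ 1])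
  from Lim_transform_eventually[OF lim this] have "((\<lambda>r::real. 1::real) \<longlongrightarrow> 2) (at_right 0)" .
  then show False
    using tendsto_const_iff[of "at_right (0::real)" "1::real" 2] by simp
qed

text \<open>
  By the density theorem for \<open>F\<close> and for its complement: no point is a density point of both.
\<close>

lemma AE_density_points_iff:
  assumes F: "F \<in> sets lebesgue"
  shows "AE x in lebesgue. x \<in> density_points F \<longleftrightarrow> x \<in> F"
proof -
  have "- F \<in> sets lebesgue" using F by (simp add: Compl_in_sets_lebesgue)
  from AE_density_point[OF this] AE_density_point[OF F] show ?thesis
    by eventually_elim (use density_points_Compl_disjoint[OF F] in auto)
qed

lemma AE_lebesgue_imp_negligible:
  assumes "AE x in lebesgue. P x"
  shows "negligible {x::'a::euclidean_space. \<not> P x}"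
  using assms unfolding negligible_iff_null_sets eventually_ae_filter
  by (auto intro: null_sets_completion_subset)

lemma sets_lebesgue_AE_cong:
  assumes F: "F \<in> sets lebesgue" and ae: "AE x in lebesgue. x \<in> G \<longleftrightarrow> x \<in> F"
  shows "G \<in> sets lebesgue"
proof -
  from ae have N: "negligible {x. \<not> (x \<in> G \<longleftrightarrow> x \<in> F)}" by (rule AE_lebesgue_imp_negligible)
  have "G = (F - (F - G)) \<union> (G - F)" by auto
  moreover have "negligible (F - G)" "negligible (G - F)"
    by (rule negligible_subset[OF N]; auto)+
  ultimately show ?thesis
    using F by (metis negligible_imp_sets sets.Diff sets.Un)
qed

lemma density_points_sets:
  assumes "F \<in> sets lebesgue" shows "density_points F \<in> sets lebesgue"
  using assms AE_density_points_iff[OF assms] by (rule sets_lebesgue_AE_cong)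

lemma density_points_cong:
  assumes "F \<in> sets lebesgue" "G \<in> sets lebesgue" "AE x in lebesgue. x \<in> F \<longleftrightarrow> x \<in> G"
  shows "density_points F = density_points G"
proof -
  have "measure lebesgue (F \<inter> ball x r) = measure lebesgue (G \<inter> ball x r)" for x r
  proof (rule measure_eq_AE)
    show "AE y in lebesgue. y \<in> F \<inter> ball x r \<longleftrightarrow> y \<in> G \<inter> ball x r"
      using assms(3) by eventually_elim auto
  qed (use assms in auto)
  then show ?thesis by (simp add: density_points_def)
qed

lemma density_point_ball_pos:
  assumes "x \<in> density_points F" and "\<delta> > 0"
  obtains r where "0 < r" "r < \<delta>" "measure lebesgue (F \<inter> ball x r) > 0"
proof -
  from assms(1) have "\<forall>\<^sub>F r in at_right 0. measure lebesgue (F \<inter> ball x r) / measure lebesgue (ball x r) > 0"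
    unfolding density_points_def mem_Collect_eq by (rule order_tendstoD(1)) simp
  moreover have "\<forall>\<^sub>F r in at_right 0. r < \<delta>" "\<forall>\<^sub>F r in at_right 0. (0::real) < r"
    using \<open>\<delta> > 0\<close> by (auto simp: eventually_at_right_field intro: exI[of _ \<delta>] exI[of _ 1])
  ultimately have "\<forall>\<^sub>F r in at_right 0. 0 < r \<and> r < \<delta> \<and> measure lebesgue (F \<inter> ball x r) > 0"
    by eventually_elim (simp add: zero_less_divide_iff)
  then obtain r where "0 < r \<and> r < \<delta> \<and> measure lebesgue (F \<inter> ball x r) > 0"
    using eventually_happens' trivial_limit_at_right_real by blast
  then show ?thesis using that by blast
qed

lemma density_points_UNIV: "density_points (UNIV :: 'a::euclidean_space set) = UNIV"
proof -
  have "((\<lambda>r. measure lebesgue (UNIV \<inter> ball x r) / measure lebesgue (ball x r)) \<longlongrightarrow> 1) (at_right 0)" for x :: 'a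
  proof (rule tendsto_eventually)
    show "\<forall>\<^sub>F r in at_right 0. measure lebesgue (UNIV \<inter> ball x r) / measure lebesgue (ball x r) = 1"
      using content_ball_pos[of _ x]
      by (auto simp: eventually_at_right_field less_imp_neq[THEN not_sym] intro!: exI[of _ 1])
  qed
  then show ?thesis by (auto simp: density_points_def)
qed

section \<open>Chain components of a set\<close>

lemma eps_connected_step:
  assumes "eps_connected \<epsilon> F x y" "z \<in> density_points F" "norm (y - z) < \<epsilon>"
  shows "eps_connected \<epsilon> F x z"
proof -
  obtain N w where w: "w 0 = x" "w N = y" "\<forall>i\<le>N. w i \<in> density_points F"
    "\<forall>i<N. norm (w i - w (Suc i)) < \<epsilon>"
    using assms(1) unfolding eps_connected_def by blast
  show ?thesis
    unfolding eps_connected_def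
    by (rule exI[of _ "Suc N"], rule exI[of _ "w(Suc N := z)"])
      (use w assms(2,3) in \<open>auto simp: le_Suc_eq less_Suc_eq\<close>)
qed

lemma eps_component_step:
  assumes "y \<in> eps_component \<epsilon> F x" "z \<in> density_points F" "norm (y - z) < \<epsilon>"
  shows "z \<in> eps_component \<epsilon> F x"
  using assms eps_connected_step[of \<epsilon> F x y z] by (simp add: eps_component_def)

lemma eps_component_self:
  assumes "x \<in> density_points F"
  shows "x \<in> eps_component \<epsilon> F x"
proof -
  have "eps_connected \<epsilon> F x x"
    unfolding eps_connected_def
    by (rule exI[of _ "0::nat"], rule exI[of _ "\<lambda>_. x"]) (simp add: assms)
  with assms show ?thesis by (simp add: eps_component_def)
qed

lemma eps_component_cong:
  assumes "density_points F = density_points G"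
  shows "eps_component \<epsilon> F x = eps_component \<epsilon> G x"
  using assms by (simp add: eps_component_def eps_connected_def)

text \<open>
  A component is relatively open in the set of density points.
\<close>

lemma eps_component_sets:
  assumes F: "F \<in> sets lebesgue" and eps: "\<epsilon> > 0"
  shows "eps_component \<epsilon> F x \<in> sets lebesgue"
proof -
  have "eps_component \<epsilon> F x = density_points F \<inter> (\<Union>y\<in>eps_component \<epsilon> F x. ball y \<epsilon>)"
    using eps by (auto simp: dist_norm intro: eps_component_step) (auto simp: eps_component_def)
  moreover have "(\<Union>y\<in>eps_component \<epsilon> F x. ball y \<epsilon>) \<in> sets lebesgue"
    by (intro sets_completionI_sets) (simp add: borel_open open_UN)
  ultimately show ?thesis
    using density_points_sets[OF F] by (metis sets.Int)
qed

text \<open>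
  Near its density point \<open>x\<close> the set \<open>F\<close> has positive measure, and almost all of its points there are
  density points at distance less than \<open>\<epsilon>\<close> from \<open>x\<close>.
\<close>

lemma eps_component_not_null:
  assumes F: "F \<in> sets lebesgue" and eps: "\<epsilon> > 0" and x: "x \<in> density_points F"
  shows "\<not> (AE y in lebesgue. y \<notin> eps_component \<epsilon> F x)"
proof
  assume null: "AE y in lebesgue. y \<notin> eps_component \<epsilon> F x"
  obtain r where r: "0 < r" "r < \<epsilon>" "measure lebesgue (F \<inter> ball x r) > 0"
    using density_point_ball_pos[OF x eps] by blast
  from null AE_density_point[OF F] have "AE y in lebesgue. y \<notin> F \<inter> ball x r"
  proof eventually_elim
    case (elim y)
    show ?case
      using elim r(2) eps_component_step[OF eps_component_self[OF x], of y \<epsilon>]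
      by (auto simp: dist_norm)
  qed
  then have "F \<inter> ball x r \<in> null_sets lebesgue"
    using F by (subst AE_iff_null_sets) auto
  then show False using r(3) by (simp add: measure_eq_0_null_sets)
qed

lemma eps_component_UNIV:
  fixes x :: "'a::euclidean_space"
  assumes "\<epsilon> > 0"
  shows "eps_component \<epsilon> UNIV x = UNIV"
proof -
  have "eps_connected \<epsilon> UNIV x y" for y :: 'a
  proof -
    obtain n :: nat where n: "norm (y - x) / \<epsilon> < real n" using reals_Archimedean2 by blast
    then have "n > 0" using assms by (metis gr_zeroI norm_ge_zero not_less divide_nonneg_pos of_nat_0)
    define z where "z i = x + (real i / real n) *\<^sub>R (y - x)" for i :: nat
    have "z i - z (Suc i) = (- 1 / real n) *\<^sub>R (y - x)" for i
      using \<open>n > 0\<close> by (simp add: z_def scaleR_left_diff_distrib[symmetric] diff_divide_distrib[symmetric])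
    then have "norm (z i - z (Suc i)) = norm (y - x) / real n" for i by simp
    moreover have "norm (y - x) / real n < \<epsilon>"
      using n \<open>n > 0\<close> assms by (simp add: field_simps)
    moreover have "z 0 = x" "z n = y" using \<open>n > 0\<close> by (auto simp: z_def)
    ultimately show ?thesis
      unfolding eps_connected_def density_points_UNIV by (intro exI[of _ n] exI[of _ z]) auto
  qed
  then show ?thesis by (auto simp: eps_component_def density_points_UNIV)
qed

section \<open>Measures on pairs of points\<close>

text \<open>
  Steinhaus: if \<open>A\<close> and \<open>B\<close> overlap in positive measure after a translation by \<open>z0\<close>, then the overlap contains
  a compact set \<open>T\<close> of positive measure.  For small \<open>h\<close> the sets \<open>T\<close> and \<open>T - h\<close> still overlap in positive
  measure, since their union lies in an open set of measure less than twice that of \<open>T\<close>.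
\<close>

lemma open_positive_correlation:
  fixes A B :: "'a::euclidean_space set"
  assumes [measurable]: "A \<in> sets borel" "B \<in> sets borel"
  shows "open {z. emeasure lborel {y \<in> B. y + z \<in> A} \<noteq> 0}"
proof (rule openI)
  fix z0 assume "z0 \<in> {z. emeasure lborel {y \<in> B. y + z \<in> A} \<noteq> 0}"
  define S where "S = {y \<in> B. y + z0 \<in> A}"
  have S[measurable]: "S \<in> sets borel" unfolding S_def by measurable
  have S0: "emeasure lborel S \<noteq> 0"
    using \<open>z0 \<in> _\<close> by (simp add: S_def)
  have "\<exists>n::nat. emeasure lborel (S \<inter> cball 0 n) \<noteq> 0"
  proof (rule ccontr)
    assume "\<not> ?thesis"
    then have "(\<Union>n::nat. S \<inter> cball 0 n) \<in> null_sets lborel"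
      by (intro null_sets_UN) (auto simp: null_sets_def)
    moreover have "(\<Union>n::nat. S \<inter> cball 0 n) = S"
      using real_arch_simple by auto
    ultimately show False using S0 by auto
  qed
  then obtain n :: nat where n: "emeasure lborel (S \<inter> cball 0 n) \<noteq> 0" by blast
  let ?\<mu> = "measure lebesgue"
  have Sn: "S \<inter> cball 0 n \<in> lmeasurable"
    by (rule bounded_set_imp_lmeasurable) auto
  have pos: "?\<mu> (S \<inter> cball 0 n) > 0"
    using n emeasure_bounded_finite[of "S \<inter> cball 0 n"] bounded_subset[OF bounded_cball, of "S \<inter> cball 0 n" 0 n]
    by (simp add: measure_def enn2real_positive_iff zero_less_iff_neq_zero)
  obtain T where T: "closed T" "T \<subseteq> S \<inter> cball 0 n" "(S \<inter> cball 0 n) - T \<in> lmeasurable"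
    "emeasure lebesgue ((S \<inter> cball 0 n) - T) < ennreal (?\<mu> (S \<inter> cball 0 n))"
    using sets_lebesgue_inner_closed[OF fmeasurableD[OF Sn] pos] by blast
  have cT: "compact T"
    using T(1,2) by (meson bounded_cball bounded_subset compact_eq_bounded_closed le_inf_iff)
  then have Tm: "T \<in> lmeasurable" by (rule lmeasurable_compact)
  have "?\<mu> (S \<inter> cball 0 n - T) < ?\<mu> (S \<inter> cball 0 n)"
    using T(3,4) pos by (simp add: emeasure_eq_measure2 ennreal_less_iff)
  moreover have "?\<mu> (S \<inter> cball 0 n - T) = ?\<mu> (S \<inter> cball 0 n) - ?\<mu> T"
    using T(2) Sn Tm by (simp add: measurable_measure_Diff fmeasurableD)
  ultimately have T0: "?\<mu> T > 0" by simp
  (* T and its translate both lie in U, which is too small to contain them disjointly. *)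
  obtain U where U: "open U" "T \<subseteq> U" "U - T \<in> lmeasurable" "emeasure lebesgue (U - T) < ennreal (?\<mu> T)"
    using sets_lebesgue_outer_open[OF fmeasurableD[OF Tm] T0] by blast
  have Um: "U \<in> lmeasurable"
    using fmeasurable.Un[OF Tm U(3)] U(2) by (simp add: Un_absorb1)
  have "?\<mu> (U - T) < ?\<mu> T"
    using U(3,4) T0 by (simp add: emeasure_eq_measure2 ennreal_less_iff)
  moreover have "?\<mu> (U - T) = ?\<mu> U - ?\<mu> T"
    using U(2) Um Tm by (simp add: measurable_measure_Diff fmeasurableD)
  ultimately have U2: "?\<mu> U < 2 * ?\<mu> T" by simp
  obtain d where d: "d > 0" "(\<Union>x\<in>T. ball x d) \<subseteq> U"
    using compact_subset_open_imp_ball_epsilon_subset[OF cT U(1,2)] by blast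
  show "\<exists>e>0. ball z0 e \<subseteq> {z. emeasure lborel {y \<in> B. y + z \<in> A} \<noteq> 0}"
  proof (intro exI[of _ d] conjI d(1) subsetI, unfold mem_Collect_eq, rule notI)
    fix z assume z: "z \<in> ball z0 d" and null: "emeasure lborel {y \<in> B. y + z \<in> A} = 0"
    define h where "h = z - z0"
    have h: "norm h < d" using z by (simp add: h_def dist_norm norm_minus_commute)
    let ?T' = "(+) (- h) ` T"
    have T'm: "?T' \<in> lmeasurable" and T': "?\<mu> ?T' = ?\<mu> T"
      using Tm by (simp_all only: measurable_translation measure_translation)
    have "T \<inter> ?T' \<subseteq> {y \<in> B. y + z \<in> A}"
    proof
      fix y assume "y \<in> T \<inter> ?T'"
      then obtain t where "y \<in> S" "t \<in> S" "y = t - h" using T(2) by auto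
      moreover from \<open>y = t - h\<close> have eq: "y + z = t + z0" by (simp add: h_def)
      ultimately show "y \<in> {y \<in> B. y + z \<in> A}" unfolding S_def mem_Collect_eq eq by blast
    qed
    moreover have "{y \<in> B. y + z \<in> A} \<in> sets lborel" by measurable
    then have "{y \<in> B. y + z \<in> A} \<in> null_sets lborel" using null by (rule null_setsI[rotated])
    ultimately have "T \<inter> ?T' \<in> null_sets lebesgue"
      by (metis null_sets_completionI null_sets_completion_subset)
    then have "?\<mu> (T \<union> ?T') = 2 * ?\<mu> T"
      using Tm T'm T' by (simp add: measure_Un3 measure_eq_0_null_sets)
    moreover have "T \<union> ?T' \<subseteq> U"
    proof -
      have "- h + t \<in> U" if "t \<in> T" for t
        using h d(2) that by (intro subsetD[OF d(2)] UN_I[of t]) (simp_all add: dist_norm)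
      then show ?thesis using U(2) by blast
    qed
    then have "?\<mu> (T \<union> ?T') \<le> ?\<mu> U"
      using Tm T'm Um by (intro measure_mono_fmeasurable sets.Un) (simp_all only: fmeasurableD)
    ultimately show False using U2 by simp
  qed
qed

lemma nn_integral_lborel_shift:
  fixes c :: "'a::euclidean_space"
  assumes [measurable]: "f \<in> borel_measurable borel"
  shows "(\<integral>\<^sup>+x. f x \<partial>lborel) = (\<integral>\<^sup>+x. f (c + x) \<partial>lborel)"
  by (subst lborel_distr_plus[of c, symmetric], subst nn_integral_distr) auto

lemma AE_lborel_shift:
  fixes c :: "'a::euclidean_space"
  assumes "AE x in lborel. P x"
  shows "AE x in lborel. P (c + x)"
proof -
  have "AE x in distr lborel borel ((+) c). P x"
    using assms by (subst lborel_distr_plus)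
  from AE_distrD[OF _ this] show ?thesis by auto
qed

text \<open>
  Integrating over the difference \<open>z\<close> of the two points last isolates the factor \<open>\<rho> z\<close> of the kernel.
\<close>

lemma nn_integral_pair_difference:
  fixes f :: "'a::euclidean_space \<times> 'a \<Rightarrow> ennreal"
  assumes [measurable]: "f \<in> borel_measurable (lborel \<Otimes>\<^sub>M lborel)"
  shows "(\<integral>\<^sup>+p. f p \<partial>(lborel \<Otimes>\<^sub>M lborel)) = (\<integral>\<^sup>+z. \<integral>\<^sup>+y. f (y + z, y) \<partial>lborel \<partial>lborel)"
proof -
  have "(\<integral>\<^sup>+p. f p \<partial>(lborel \<Otimes>\<^sub>M lborel)) = (\<integral>\<^sup>+y. \<integral>\<^sup>+x. f (x, y) \<partial>lborel \<partial>lborel)"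
    by (rule lborel_pair.nn_integral_snd[symmetric]) simp
  also have "\<dots> = (\<integral>\<^sup>+y. \<integral>\<^sup>+z. f (y + z, y) \<partial>lborel \<partial>lborel)"
    by (intro nn_integral_cong nn_integral_lborel_shift) measurable
  also have "\<dots> = (\<integral>\<^sup>+z. \<integral>\<^sup>+y. f (y + z, y) \<partial>lborel \<partial>lborel)"
    by (rule lborel_pair.Fubini') measurable
  finally show ?thesis .
qed

lemma AE_pair_fst:
  fixes P :: "'a::euclidean_space \<Rightarrow> bool"
  assumes "AE x in lborel. P x"
  shows "AE p in lborel \<Otimes>\<^sub>M (lborel :: 'a measure). P (fst p)"
proof -
  obtain N where N: "N \<in> null_sets lborel" "{x. \<not> P x} \<subseteq> N"
    using assms by (auto elim!: AE_E3 simp: eventually_ae_filter)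
  have "N \<times> UNIV \<in> null_sets (lborel \<Otimes>\<^sub>M (lborel :: 'a measure))"
    using N(1) by (auto simp: null_sets_def lborel.emeasure_pair_measure_Times)
  then show ?thesis
    by (rule AE_I') (use N(2) in auto)
qed

lemma AE_pair_snd:
  fixes P :: "'a::euclidean_space \<Rightarrow> bool"
  assumes "AE x in lborel. P x"
  shows "AE p in (lborel :: 'a measure) \<Otimes>\<^sub>M lborel. P (snd p)"
proof -
  obtain N where N: "N \<in> null_sets lborel" "{x. \<not> P x} \<subseteq> N"
    using assms by (auto elim!: AE_E3 simp: eventually_ae_filter)
  have "UNIV \<times> N \<in> null_sets ((lborel :: 'a measure) \<Otimes>\<^sub>M lborel)"
    using N(1) by (auto simp: null_sets_def lborel.emeasure_pair_measure_Times)
  then show ?thesis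
    by (rule AE_I') (use N(2) in auto)
qed

lemma AE_pair_difference:
  fixes P :: "'a::euclidean_space \<Rightarrow> bool"
  assumes "AE z in lborel. P z"
  shows "AE p in lborel \<Otimes>\<^sub>M lborel. P (fst p - snd p)"
proof -
  obtain N where N: "N \<in> null_sets lborel" "{x. \<not> P x} \<subseteq> N"
    using assms by (auto elim!: AE_E3 simp: eventually_ae_filter)
  have [measurable]: "N \<in> sets borel" using N(1) by auto
  have "(\<integral>\<^sup>+p. indicator N (fst p - snd p) \<partial>(lborel \<Otimes>\<^sub>M lborel)) =
      (\<integral>\<^sup>+z. \<integral>\<^sup>+y. indicator N z \<partial>(lborel :: 'a measure) \<partial>lborel)"
    by (subst nn_integral_pair_difference) auto
  also have "\<dots> = (\<integral>\<^sup>+z. 0 \<partial>(lborel :: 'a measure))"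
    by (rule nn_integral_cong_AE, use AE_not_in[OF N(1)] in eventually_elim) simp
  finally have "(\<integral>\<^sup>+p. indicator N (fst p - snd p) \<partial>(lborel \<Otimes>\<^sub>M (lborel :: 'a measure))) = 0"
    by simp
  then have "AE p in lborel \<Otimes>\<^sub>M lborel. indicator N (fst p - snd p) = (0::ennreal)"
    by (subst (asm) nn_integral_0_iff_AE) auto
  then show ?thesis
    by eventually_elim (use N(2) in \<open>auto split: split_indicator_asm\<close>)
qed

lemma AE_pair_swap:
  assumes "AE p in lborel \<Otimes>\<^sub>M lborel. P (fst p) (snd p)"
  shows "AE p in lborel \<Otimes>\<^sub>M (lborel :: 'a::euclidean_space measure). P (snd p) (fst p)"
proof -
  have "AE p in distr (lborel \<Otimes>\<^sub>M (lborel :: 'a measure)) (lborel \<Otimes>\<^sub>M lborel) (\<lambda>(x, y). (y, x)). P (fst p) (snd p)"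
    using assms by (subst lborel_pair.distr_pair_swap[symmetric])
  from AE_distrD[OF measurable_pair_swap' this] show ?thesis
    by (simp add: case_prod_unfold)
qed

section \<open>Null sets and positive measure\<close>

lemma lebesgue_set_borel_version:
  assumes "E \<in> sets (lebesgue :: 'a::euclidean_space measure)"
  obtains E' where "E' \<in> sets borel" "AE x in lebesgue. x \<in> E' \<longleftrightarrow> x \<in> E"
proof -
  obtain E' where E': "E \<subseteq> E'" "E' \<in> sets lborel" "E' - E \<in> null_sets lebesgue"
    using completion_upper[OF assms] by blast
  from AE_not_in[OF E'(3)] have "AE x in lebesgue. x \<in> E' \<longleftrightarrow> x \<in> E"
    by eventually_elim (use E'(1) in auto)
  with E'(2) that show ?thesis by simp
qed

lemma emeasure_pos_iff_not_AE:
  assumes "S \<in> sets M"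
  shows "0 < emeasure M S \<longleftrightarrow> \<not> (AE x in M. x \<notin> S)"
  using AE_iff_null_sets[OF assms] assms by (auto simp: null_sets_def zero_less_iff_neq_zero)

lemma emeasure_finite_if_bounded_below:
  fixes f :: "'a::euclidean_space \<Rightarrow> real"
  assumes f: "integrable lborel f" and S: "S \<in> sets borel"
    and t: "t > 0" "\<And>x. x \<in> S \<Longrightarrow> t \<le> \<bar>f x\<bar>"
  shows "emeasure lborel S < \<infinity>"
proof -
  have "integrable lborel (indicat_real S)"
  proof (rule Bochner_Integration.integrable_bound)
    show "integrable lborel (\<lambda>x. f x / t)" using f by simp
    show "AE x in lborel. norm (indicat_real S x) \<le> norm (f x / t)"
      using t by (auto intro!: always_eventually simp: le_divide_eq split: split_indicator)
  qed (use S in simp)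
  then show ?thesis by (simp add: integrable_indicator_iff)
qed

section \<open>Real and extended real numbers\<close>

lemma ennreal_mult_eq_1D:
  assumes "a * P = (1::ennreal)"
  shows "0 < P" "P < top"
proof -
  have "a \<noteq> 0" "P \<noteq> 0" using assms by auto
  moreover have "a * P \<noteq> top" using assms by simp
  ultimately show "0 < P" "P < top"
    unfolding ennreal_mult_eq_top_iff by (auto simp: less_top zero_less_iff_neq_zero)
qed

text \<open>
  Clipping to \<open>{s..t}\<close> cannot act as one common factor on two different nonzero numbers: a level between them
  (or above both, when their signs differ) fixes one of them and moves the other.
\<close>

lemma clip_proportional:
  fixes \<alpha> :: "real \<Rightarrow> real \<Rightarrow> real" and a b :: real
  assumes "\<And>s t x. s \<in> \<rat> \<Longrightarrow> t \<in> \<rat> \<Longrightarrow> s \<le> 0 \<Longrightarrow> 0 \<le> t \<Longrightarrow> x \<in> {a, b} \<Longrightarrow> max s (min t x) = \<alpha> s t * x"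
    and "a < b" "a \<noteq> 0" "b \<noteq> 0"
  shows False
proof -
  consider "0 < a" | "a < 0" "0 < b" | "b < 0" using assms(2-4) by linarith
  then show False
  proof cases
    case 1
    obtain t where t: "t \<in> \<rat>" "a < t" "t < b" using Rats_dense_in_real assms(2) by blast
    have "a = \<alpha> 0 t * a" "t = \<alpha> 0 t * b"
      using assms(1)[of 0 t a] assms(1)[of 0 t b] t 1 by (auto simp: max_def min_def)
    then show False using 1 t by simp
  next
    case 2
    obtain t where t: "t \<in> \<rat>" "b < t" "t < b + 1" using Rats_dense_in_real[of b "b + 1"] by auto
    have "0 = \<alpha> 0 t * a" "b = \<alpha> 0 t * b"
      using assms(1)[of 0 t a] assms(1)[of 0 t b] t 2 by (auto simp: max_def min_def)
    then show False using 2 by simp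
  next
    case 3
    obtain s where s: "s \<in> \<rat>" "a < s" "s < b" using Rats_dense_in_real assms(2) by blast
    have "s = \<alpha> s 0 * a" "b = \<alpha> s 0 * b"
      using assms(1)[of s 0 a] assms(1)[of s 0 b] s 3 by (auto simp: max_def min_def)
    then show False using 3 s by simp
  qed
qed

lemma convex_combination_same_modulus:
  fixes c :: real
  assumes t: "0 < t" "t < 1" and c: "c = (1 - t) * \<kappa> + t * \<mu>" and le: "\<bar>\<kappa>\<bar> \<le> \<bar>c\<bar>" "\<bar>\<mu>\<bar> \<le> \<bar>c\<bar>"
  shows "\<kappa> = \<mu>"
proof -
  have eq: "\<kappa>' = \<mu>'" if "c' = (1 - t) * \<kappa>' + t * \<mu>'" "\<kappa>' \<le> c'" "\<mu>' \<le> c'" for c' \<kappa>' \<mu>' :: real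
  proof -
    have "(1 - t) * (c' - \<kappa>') + t * (c' - \<mu>') = 0" using that(1) by (simp add: algebra_simps)
    moreover have "(1 - t) * (c' - \<kappa>') \<ge> 0" "t * (c' - \<mu>') \<ge> 0" using that(2,3) t by simp_all
    ultimately have "(1 - t) * (c' - \<kappa>') = 0" "t * (c' - \<mu>') = 0" by linarith+
    then show ?thesis using t by simp
  qed
  show ?thesis
  proof (cases "c \<ge> 0")
    case True
    then show ?thesis using eq[OF c] le by linarith
  next
    case False
    have "- c = (1 - t) * (- \<kappa>) + t * (- \<mu>)" using c by (simp add: algebra_simps)
    from eq[OF this] show ?thesis using False le by linarith
  qed
qed

section \<open>The seminorm as an integral over interacting pairs\<close>

text \<open>
  For a Lebesgue measurable \<open>\<rho>\<close> the function \<open>(x, y) \<mapsto> \<rho> (x - y)\<close> need not be measurable for the product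
  of the Borel structures, on which Tonelli's theorem is used below.
\<close>

definition borel_version :: "('a::euclidean_space \<Rightarrow> ennreal) \<Rightarrow> 'a \<Rightarrow> ennreal" where
  "borel_version \<rho> = (SOME g. g \<in> borel_measurable borel \<and> (AE x in lborel. \<rho> x = g x))"

definition interaction :: "('a::euclidean_space \<Rightarrow> ennreal) \<Rightarrow> ('a \<times> 'a) measure" where
  "interaction \<rho> = density (lborel \<Otimes>\<^sub>M lborel)
    (\<lambda>p. ennreal (1 / norm (fst p - snd p)) * borel_version \<rho> (fst p - snd p))"

definition variation :: "('a::euclidean_space \<Rightarrow> ennreal) \<Rightarrow> ('a \<Rightarrow> real) \<Rightarrow> ennreal" where
  "variation \<rho> u = (\<integral>\<^sup>+p. ennreal \<bar>u (fst p) - u (snd p)\<bar> \<partial>interaction \<rho>)"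

lemma borel_version:
  assumes "\<rho> \<in> borel_measurable lebesgue"
  shows measurable_borel_version: "borel_version \<rho> \<in> borel_measurable borel"
    and AE_borel_version: "AE x in lborel. \<rho> x = borel_version \<rho> x"
proof -
  have "\<exists>g. g \<in> borel_measurable borel \<and> (AE x in lborel. \<rho> x = g x)"
    using completion_ex_borel_measurable[OF assms] by auto
  from someI_ex[OF this, folded borel_version_def]
  show "borel_version \<rho> \<in> borel_measurable borel" "AE x in lborel. \<rho> x = borel_version \<rho> x" by auto
qed

lemma sets_interaction [measurable_cong]: "sets (interaction \<rho>) = sets (lborel \<Otimes>\<^sub>M lborel)"
  by (simp add: interaction_def)

text \<open>
  For each fixed \<open>y\<close> the translated kernel and its Borel version agree for almost every \<open>x\<close>, so the inner
  integrals agree.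
\<close>

lemma seminorm_fun_eq_variation:
  assumes \<rho>: "\<rho> \<in> borel_measurable lebesgue" and u [measurable]: "u \<in> borel_measurable borel"
  shows "seminorm_fun \<rho> u = variation \<rho> u"
proof -
  note [measurable] = measurable_borel_version[OF \<rho>]
  let ?f = "\<lambda>x y. ennreal (\<bar>u x - u y\<bar> / norm (x - y)) * borel_version \<rho> (x - y)"
  have "variation \<rho> u = (\<integral>\<^sup>+p. ?f (fst p) (snd p) \<partial>(lborel \<Otimes>\<^sub>M lborel))"
    unfolding variation_def interaction_def
    by (subst nn_integral_density)
      (auto intro!: nn_integral_cong simp: ennreal_mult'[symmetric] mult_ac divide_inverse)
  also have "\<dots> = (\<integral>\<^sup>+y. \<integral>\<^sup>+x. ?f x y \<partial>lborel \<partial>lborel)"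
    by (subst lborel_pair.nn_integral_snd[symmetric]) (auto simp: case_prod_unfold)
  also have "\<dots> = (\<integral>\<^sup>+y. \<integral>\<^sup>+x. ennreal (\<bar>u x - u y\<bar> / norm (x - y)) * \<rho> (x - y) \<partial>lborel \<partial>lborel)"
  proof (rule nn_integral_cong, rule nn_integral_cong_AE)
    fix y
    have "AE x in lborel. \<rho> (- y + x) = borel_version \<rho> (- y + x)"
      by (rule AE_lborel_shift[OF AE_borel_version[OF \<rho>]])
    then show "AE x in lborel. ?f x y = ennreal (\<bar>u x - u y\<bar> / norm (x - y)) * \<rho> (x - y)"
      by eventually_elim simp
  qed
  finally show ?thesis
    by (simp add: seminorm_fun_def nn_integral_completion)
qed

lemma AE_interactionI:
  assumes "AE p in lborel \<Otimes>\<^sub>M lborel. P p" "\<rho> \<in> borel_measurable lebesgue"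
  shows "AE p in interaction \<rho>. P p"
proof -
  note [measurable] = measurable_borel_version[OF assms(2)]
  show ?thesis unfolding interaction_def
    by (subst AE_density) (use assms(1) in auto)
qed

section \<open>Interaction and distance\<close>

locale nonlocal_kernel =
  fixes \<epsilon> :: real and \<rho> :: "'a::euclidean_space \<Rightarrow> ennreal"
  assumes eps: "\<epsilon> > 0"
    and meas: "\<rho> \<in> borel_measurable lebesgue"
    and supp: "is_ess_support \<rho> (cball 0 \<epsilon>)"
begin

abbreviation "\<rho>' \<equiv> borel_version \<rho>"
abbreviation "lborel2 \<equiv> lborel \<Otimes>\<^sub>M (lborel :: 'a measure)"

lemma measurable_kernel [measurable]: "\<rho>' \<in> borel_measurable borel"
  by (rule measurable_borel_version[OF meas])

text \<open>
  The kernel vanishes almost everywhere outside the closed ball, and the sphere is a null set.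
\<close>

lemma AE_interaction_near:
  assumes "AE p in lborel2. norm (fst p - snd p) < \<epsilon> \<longrightarrow> P p"
  shows "AE p in interaction \<rho>. P p"
proof -
  have "AE x in lborel. x \<notin> cball 0 \<epsilon> \<longrightarrow> \<rho> x = 0"
    using supp by (simp add: is_ess_support_def AE_completion_iff)
  moreover have "AE x in lborel. x \<notin> sphere (0::'a) \<epsilon>"
    using AE_not_in[of "sphere 0 \<epsilon>" "lebesgue::'a measure"] negligible_sphere[of 0 \<epsilon>]
    by (simp add: negligible_iff_null_sets AE_completion_iff)
  ultimately have "AE x in lborel. \<rho>' x \<noteq> 0 \<longrightarrow> norm x < \<epsilon>"
    using AE_borel_version[OF meas] by eventually_elim auto
  from AE_pair_difference[OF this] assms
  have "AE p in lborel2. 0 < ennreal (1 / norm (fst p - snd p)) * \<rho>' (fst p - snd p) \<longrightarrow> P p"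
    by eventually_elim (auto simp: zero_less_iff_neq_zero)
  then show ?thesis
    unfolding interaction_def by (subst AE_density) measurable
qed

text \<open>
  The converse of \<open>AE_interaction_near\<close> for rectangles.  The interaction of \<open>A\<close> and \<open>B\<close> is the integral over \<open>z\<close>
  of the kernel times the measure \<open>c z\<close> of the pairs with difference \<open>z\<close>.  If it is zero, then \<open>\<rho>\<close> vanishes
  almost everywhere outside the closed set where \<open>c\<close> vanishes, which therefore contains the essential support.
\<close>

lemma AE_near_rectangle:
  assumes [measurable]: "A \<in> sets borel" "B \<in> sets borel"
    and null: "AE p in interaction \<rho>. \<not> (fst p \<in> A \<and> snd p \<in> B)"
  shows "AE p in lborel2. norm (fst p - snd p) < \<epsilon> \<longrightarrow> \<not> (fst p \<in> A \<and> snd p \<in> B)"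
proof -
  (* the measure of the pairs in A \<times> B with difference z *)
  define c where "c z = emeasure lborel {y \<in> B. y + z \<in> A}" for z
  define k where "k z = ennreal (1 / norm z) * \<rho>' z" for z :: 'a
  have [measurable]: "k \<in> borel_measurable borel" unfolding k_def by measurable
  have c_int: "(\<integral>\<^sup>+p. h (fst p - snd p) * indicator (A \<times> B) p \<partial>lborel2) = (\<integral>\<^sup>+z. h z * c z \<partial>lborel)"
    if [measurable]: "h \<in> borel_measurable borel" for h
  proof -
    have "(\<integral>\<^sup>+p. h (fst p - snd p) * indicator (A \<times> B) p \<partial>lborel2) =
        (\<integral>\<^sup>+z. \<integral>\<^sup>+y. h z * indicator {y \<in> B. y + z \<in> A} y \<partial>lborel \<partial>lborel)"
      by (subst nn_integral_pair_difference)
        (auto intro!: nn_integral_cong split: split_indicator)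
    also have "\<dots> = (\<integral>\<^sup>+z. h z * c z \<partial>lborel)"
      by (intro nn_integral_cong) (simp add: nn_integral_cmult_indicator c_def)
    finally show ?thesis .
  qed
  have "AE p in lborel2. k (fst p - snd p) * indicator (A \<times> B) p = 0"
    using null unfolding interaction_def k_def[symmetric]
    by (subst (asm) AE_density) (measurable, elim eventually_mono, auto split: split_indicator simp: zero_less_iff_neq_zero)
  then have "(\<integral>\<^sup>+z. k z * c z \<partial>lborel) = 0"
    by (subst c_int[symmetric]) (auto simp: nn_integral_0_iff_AE)
  moreover have [measurable]: "c \<in> borel_measurable borel"
  proof -
    have "c z = (\<integral>\<^sup>+y. indicator A (y + z) * indicator B y \<partial>lborel)" for z
    proof -
      have "c z = (\<integral>\<^sup>+y. indicator {y \<in> B. y + z \<in> A} y \<partial>lborel)"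
        unfolding c_def by (rule nn_integral_indicator[symmetric]) measurable
      also have "\<dots> = (\<integral>\<^sup>+y. indicator A (y + z) * indicator B y \<partial>lborel)"
        by (intro nn_integral_cong) (simp split: split_indicator)
      finally show ?thesis .
    qed
    then show ?thesis by (subst (1) ext[of c]) (assumption, measurable)
  qed
  ultimately have "AE z in lborel. k z * c z = 0"
    by (subst (asm) nn_integral_0_iff_AE) auto
  moreover have "AE z in lborel. z \<noteq> (0::'a)" by (rule AE_lborel_singleton)
  ultimately have "AE z in lborel. z \<notin> {z. c z = 0} \<longrightarrow> \<rho> z = 0"
    using AE_borel_version[OF meas]
    by eventually_elim (auto simp: k_def)
  (* The essential support lies in every closed set outside of which the kernel vanishes. *)
  moreover have "closed {z. c z = 0}"
    unfolding closed_def using open_positive_correlation[of A B]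
    by (simp add: c_def Collect_neg_eq[symmetric])
  ultimately have "cball 0 \<epsilon> \<subseteq> {z. c z = 0}"
    using supp unfolding is_ess_support_def AE_completion_iff by blast
  then have "c z = 0" if "norm z < \<epsilon>" for z
    using that by (meson less_imp_le mem_Collect_eq mem_cball_0 subsetD)
  then have "(\<integral>\<^sup>+z. indicator (ball 0 \<epsilon>) z * c z \<partial>lborel) = (\<integral>\<^sup>+z. 0 \<partial>(lborel :: 'a measure))"
    by (intro nn_integral_cong) (auto split: split_indicator)
  moreover have ball [measurable]: "(indicator (ball 0 \<epsilon>) :: 'a \<Rightarrow> ennreal) \<in> borel_measurable borel"
    by (rule borel_measurable_indicator) simp
  ultimately have "(\<integral>\<^sup>+p. indicator (ball 0 \<epsilon>) (fst p - snd p) * indicator (A \<times> B) p \<partial>lborel2) = 0"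
    by (simp only: c_int[OF ball] nn_integral_const mult_zero_left)
  moreover have "(\<lambda>p. indicator (ball 0 \<epsilon>) (fst p - snd p) * indicator (A \<times> B) p :: ennreal)
      \<in> borel_measurable lborel2"
    by measurable
  ultimately have "AE p in lborel2. indicator (ball 0 \<epsilon>) (fst p - snd p) * indicator (A \<times> B) p = (0::ennreal)"
    by (simp only: nn_integral_0_iff_AE)
  then show ?thesis
    by eventually_elim (auto split: split_indicator_asm)
qed

text \<open>
  The kernel may distinguish \<open>z\<close> from \<open>- z\<close>, but nullity of a rectangle depends only on the distances of its points.
\<close>

lemma AE_interaction_rectangle_swap:
  assumes "A \<in> sets borel" "B \<in> sets borel"
    and "AE p in interaction \<rho>. \<not> (fst p \<in> A \<and> snd p \<in> B)"
  shows "AE p in interaction \<rho>. \<not> (fst p \<in> B \<and> snd p \<in> A)"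
  using AE_pair_swap[OF AE_near_rectangle[OF assms]]
  by (intro AE_interaction_near) (auto simp: norm_minus_commute elim: eventually_mono)

text \<open>
  Chains cannot leave \<open>F1\<close>: near a point \<open>b\<close> that is close to a density point of \<open>F1\<close>, the set \<open>F2\<close> is null,
  so \<open>F\<close> and \<open>F1\<close> have the same density at \<open>b\<close>.
\<close>

lemma density_point_step:
  assumes [measurable]: "F1 \<in> sets borel" "F2 \<in> sets borel" and F: "F \<in> sets lebesgue"
    and null: "AE p in interaction \<rho>. \<not> (fst p \<in> F1 \<and> snd p \<in> F2)"
    and part: "AE x in lebesgue. x \<in> F \<longleftrightarrow> x \<in> F1 \<or> x \<in> F2"
    and a: "a \<in> density_points F1" and b: "b \<in> density_points F" and ab: "norm (a - b) < \<epsilon>"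
  shows "b \<in> density_points F1"
proof -
  obtain r where r: "0 < r" "r < (\<epsilon> - norm (a - b)) / 2" "measure lebesgue (F1 \<inter> ball a r) > 0"
    using density_point_ball_pos[OF a, of "(\<epsilon> - norm (a - b)) / 2"] ab by auto
  (* r is so small that the two balls of radius r contain only pairs at distance below \<epsilon>;
     as F1 charges the first ball, F2 is null in the second. *)
  have near: "norm (x - y) < \<epsilon>" if "x \<in> ball a r" "y \<in> ball b r" for x y
  proof -
    have "norm (x - y) \<le> norm (x - a) + norm (a - b) + norm (b - y)"
      by norm
    then show ?thesis using that r(2) by (simp add: dist_norm norm_minus_commute)
  qed
  have "AE p in lborel2. p \<notin> (F1 \<inter> ball a r) \<times> (F2 \<inter> ball b r)"
    using AE_near_rectangle[OF assms(1,2) null] by eventually_elim (auto dest: near)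
  moreover have "(F1 \<inter> ball a r) \<times> (F2 \<inter> ball b r) \<in> sets lborel2"
    by (rule pair_measureI) simp_all
  ultimately have "emeasure lborel2 ((F1 \<inter> ball a r) \<times> (F2 \<inter> ball b r)) = 0"
    by (simp add: AE_iff_null_sets[symmetric] null_setsD1)
  then have "emeasure lborel (F1 \<inter> ball a r) * emeasure lborel (F2 \<inter> ball b r) = 0"
    by (subst (asm) lborel.emeasure_pair_measure_Times) auto
  moreover have "emeasure lborel (F1 \<inter> ball a r) \<noteq> 0"
    using r(3) by (auto simp: measure_def)
  ultimately have "F2 \<inter> ball b r \<in> null_sets lborel" by auto
  then have n2: "AE x in lebesgue. x \<notin> F2 \<inter> ball b r"
    by (intro AE_completion AE_not_in)
  have "measure lebesgue (F \<inter> ball b s) = measure lebesgue (F1 \<inter> ball b s)" if s: "0 < s" "s < r" for s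
  proof (rule measure_eq_AE)
    show "AE x in lebesgue. x \<in> F \<inter> ball b s \<longleftrightarrow> x \<in> F1 \<inter> ball b s"
      using part n2 by eventually_elim (use s in auto)
  qed (use F in auto)
  then have "\<forall>\<^sub>F s in at_right 0. measure lebesgue (F \<inter> ball b s) / measure lebesgue (ball b s) =
      measure lebesgue (F1 \<inter> ball b s) / measure lebesgue (ball b s)"
    using r(1) by (auto simp: eventually_at_right_field intro!: exI[of _ r])
  with b show ?thesis
    unfolding density_points_def by (auto intro: Lim_transform_eventually)
qed

lemma eps_component_subset_density_points:
  assumes "F1 \<in> sets borel" "F2 \<in> sets borel" "F \<in> sets lebesgue"
    and "AE p in interaction \<rho>. \<not> (fst p \<in> F1 \<and> snd p \<in> F2)"
    and "AE x in lebesgue. x \<in> F \<longleftrightarrow> x \<in> F1 \<or> x \<in> F2"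
    and x: "x \<in> density_points F1"
  shows "eps_component \<epsilon> F x \<subseteq> density_points F1"
proof
  fix y assume "y \<in> eps_component \<epsilon> F x"
  then obtain N z where z: "z 0 = x" "z N = y" "\<And>i. i \<le> N \<Longrightarrow> z i \<in> density_points F"
    "\<And>i. i < N \<Longrightarrow> norm (z i - z (Suc i)) < \<epsilon>"
    unfolding eps_component_def eps_connected_def by blast
  have "i \<le> N \<Longrightarrow> z i \<in> density_points F1" for i
  proof (induction i)
    case (Suc i)
    then show ?case
      using density_point_step[OF assms(1-5), of "z i" "z (Suc i)"] z(3)[of "Suc i"] z(4)[of i] by simp
  qed (simp add: z(1) x)
  then show "y \<in> density_points F1" using z(2) by blast
qed

text \<open>
  A density point of \<open>F1\<close> would have its whole component of \<open>F\<close> in the density points of \<open>F1\<close>, a set of finite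
  measure.
\<close>

lemma null_if_no_finite_component:
  assumes F1: "F1 \<in> sets borel" and F2: "F2 \<in> sets borel" and F: "F \<in> sets lebesgue"
    and null: "AE p in interaction \<rho>. \<not> (fst p \<in> F1 \<and> snd p \<in> F2)"
    and part: "AE x in lebesgue. x \<in> F \<longleftrightarrow> x \<in> F1 \<or> x \<in> F2"
    and fin: "emeasure lborel F1 < \<infinity>"
    and comp: "\<not> (\<exists>x \<in> density_points F. emeasure lebesgue (eps_component \<epsilon> F x) < \<infinity>)"
  shows "AE x in lebesgue. x \<notin> F1"
proof -
  have F1L: "F1 \<in> sets lebesgue" using F1 by simp
  have no: "\<not> (x \<in> density_points F \<and> x \<in> density_points F1)" for x
  proof safe
    assume x: "x \<in> density_points F" "x \<in> density_points F1"
    have "emeasure lebesgue (eps_component \<epsilon> F x) \<le> emeasure lebesgue (density_points F1)"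
      by (intro emeasure_mono density_points_sets F1L
        eps_component_subset_density_points[OF F1 F2 F null part x(2)])
    also have "\<dots> = emeasure lebesgue F1"
      using AE_density_points_iff[OF F1L] by (intro emeasure_eq_AE density_points_sets F1L)
    also have "\<dots> < \<infinity>" using fin F1 by simp
    finally show False using comp x(1) by blast
  qed
  from AE_density_point[OF F] AE_density_point[OF F1L] part show ?thesis
    by eventually_elim (use no in blast)
qed

lemma AE_zero_if_locally_constant:
  fixes f :: "'a \<Rightarrow> real"
  assumes f: "integrable lborel f" and F: "F \<in> sets borel"
    and const: "AE p in interaction \<rho>. fst p \<in> F \<and> snd p \<in> F \<longrightarrow> f (fst p) = f (snd p)"
    and comp: "\<not> (\<exists>x \<in> density_points F. emeasure lebesgue (eps_component \<epsilon> F x) < \<infinity>)"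
  shows "AE x in lebesgue. x \<in> F \<longrightarrow> f x = 0"
proof -
  note [measurable] = borel_measurable_integrable[OF f] F
  (* A superlevel set of the absolute value has finite measure and does not interact with the rest of F. *)
  have "AE x in lebesgue. x \<notin> {x \<in> F. \<bar>f x\<bar> > inverse (real (Suc n))}" for n
  proof (rule null_if_no_finite_component[OF _ _ _ _ _ _ comp])
    let ?t = "inverse (real (Suc n))"
    show "{x \<in> F. \<bar>f x\<bar> > ?t} \<in> sets borel" "{x \<in> F. \<bar>f x\<bar> \<le> ?t} \<in> sets borel" by measurable
    show "F \<in> sets lebesgue" using F by simp
    show "AE p in interaction \<rho>. \<not> (fst p \<in> {x \<in> F. \<bar>f x\<bar> > ?t} \<and> snd p \<in> {x \<in> F. \<bar>f x\<bar> \<le> ?t})"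
      using const by eventually_elim auto
    show "AE x in lebesgue. x \<in> F \<longleftrightarrow> x \<in> {x \<in> F. \<bar>f x\<bar> > ?t} \<or> x \<in> {x \<in> F. \<bar>f x\<bar> \<le> ?t}"
      by (auto intro!: always_eventually)
    show "emeasure lborel {x \<in> F. \<bar>f x\<bar> > ?t} < \<infinity>"
      by (rule emeasure_finite_if_bounded_below[OF f, where t = ?t]) auto
  qed
  then have "AE x in lebesgue. \<forall>n. x \<notin> {x \<in> F. \<bar>f x\<bar> > inverse (real (Suc n))}"
    unfolding AE_all_countable by blast
  then show ?thesis
  proof eventually_elim
    case (elim x)
    show ?case
    proof (rule impI, rule ccontr)
      assume "x \<in> F" "f x \<noteq> 0"
      then obtain n where "inverse (real (Suc n)) < \<bar>f x\<bar>"
        using reals_Archimedean[of "\<bar>f x\<bar>"] by auto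
      then show False using elim \<open>x \<in> F\<close> by auto
    qed
  qed
qed

end

section \<open>Representatives of integrable classes\<close>

lemma L1_rel_refl_iff: "L1_rel f f \<longleftrightarrow> integrable lebesgue f"
  by (auto simp: L1_rel_def)

lemma abs_L1_eq_iff:
  assumes "integrable lebesgue f" "integrable lebesgue g"
  shows "abs_L1 f = abs_L1 g \<longleftrightarrow> (AE x in lebesgue. f x = g x)"
  using Quotient_rel[OF Quotient_L1, of f g] assms by (auto simp: L1_rel_def)

lemma integrable_lebesgueI:
  fixes f :: "'a::euclidean_space \<Rightarrow> real"
  shows "integrable lborel f \<Longrightarrow> integrable lebesgue f"
  by (subst integrable_completion) auto

text \<open>
  Borel representatives make the integrand of the seminorm measurable on pairs of points.
\<close>

lemma borel_representative:
  obtains f where "integrable lborel f" "u = abs_L1 f"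
proof -
  define g where "g = rep_L1 u"
  have rel: "L1_rel g g" "abs_L1 g = u"
    using Quotient_rep_reflp[OF Quotient_L1, of u] Quotient_abs_rep[OF Quotient_L1, of u]
    by (simp_all add: g_def)
  then have g: "integrable lebesgue g" by (simp add: L1_rel_def)
  obtain f where f: "f \<in> borel_measurable lborel" "AE x in lborel. g x = f x"
    using completion_ex_borel_measurable_real[OF borel_measurable_integrable[OF g]] by auto
  have ae: "AE x in lebesgue. g x = f x" by (rule AE_completion[OF f(2)])
  have "integrable lebesgue f"
    using g by (rule Bochner_Integration.integrable_cong_AE_imp)
      (use f(1) ae in \<open>auto intro: measurable_completion\<close>)
  moreover from this have "integrable lborel f" using integrable_completion[OF f(1)] by simp
  moreover have "u = abs_L1 f"
    using abs_L1_eq_iff[OF g \<open>integrable lebesgue f\<close>] ae rel(2) by simp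
  ultimately show ?thesis using that by blast
qed

lemma
  assumes "integrable lebesgue f"
  shows scaleR_abs_L1: "c *\<^sub>R abs_L1 f = abs_L1 (\<lambda>x. c * f x)"
    and seminorm_abs_L1: "seminorm_L1 \<rho> (abs_L1 f) = seminorm_fun \<rho> f"
  using assms by (auto simp: scaleR_L1.abs_eq seminorm_L1.abs_eq L1_rel_refl_iff)

lemma plus_abs_L1:
  assumes "integrable lebesgue f" "integrable lebesgue g"
  shows "abs_L1 f + abs_L1 g = abs_L1 (\<lambda>x. f x + g x)"
  using assms by (auto simp: plus_L1.abs_eq L1_rel_refl_iff)

section \<open>The seminorm is a norm\<close>

context nonlocal_kernel
begin

lemma seminorm_eq_variation:
  assumes "integrable lborel f"
  shows "seminorm_L1 \<rho> (abs_L1 f) = variation \<rho> f"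
  using assms borel_measurable_integrable[OF assms]
  by (simp add: seminorm_abs_L1 integrable_lebesgueI seminorm_fun_eq_variation[OF meas])

lemma variation_eq_0_iff:
  assumes [measurable]: "f \<in> borel_measurable borel"
  shows "variation \<rho> f = 0 \<longleftrightarrow> (AE p in interaction \<rho>. f (fst p) = f (snd p))"
  unfolding variation_def by (subst nn_integral_0_iff_AE) auto

text \<open>
  Additivity needs equality in the triangle inequality, which will come from monotone functions of a common
  function or from sets that do not interact.
\<close>

lemma variation_add:
  assumes [measurable]: "f \<in> borel_measurable borel" "g \<in> borel_measurable borel"
    and "AE p in interaction \<rho>. \<bar>(f (fst p) + g (fst p)) - (f (snd p) + g (snd p))\<bar> =
      \<bar>f (fst p) - f (snd p)\<bar> + \<bar>g (fst p) - g (snd p)\<bar>"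
  shows "variation \<rho> (\<lambda>x. f x + g x) = variation \<rho> f + variation \<rho> g"
proof -
  have "variation \<rho> (\<lambda>x. f x + g x) =
    (\<integral>\<^sup>+p. ennreal \<bar>f (fst p) - f (snd p)\<bar> + ennreal \<bar>g (fst p) - g (snd p)\<bar> \<partial>interaction \<rho>)"
    unfolding variation_def by (rule nn_integral_cong_AE, use assms(3) in eventually_elim) simp
  also have "\<dots> = variation \<rho> f + variation \<rho> g"
    unfolding variation_def by (rule nn_integral_add) measurable
  finally show ?thesis .
qed

lemma variation_scale:
  assumes [measurable]: "f \<in> borel_measurable borel"
  shows "variation \<rho> (\<lambda>x. c * f x) = ennreal \<bar>c\<bar> * variation \<rho> f"
  unfolding variation_def
  by (subst nn_integral_cmult[symmetric])
    (auto intro!: nn_integral_cong simp: ennreal_mult'[symmetric] abs_mult[symmetric] right_diff_distrib)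

lemma seminorm_scale: "seminorm_L1 \<rho> (c *\<^sub>R u) = ennreal \<bar>c\<bar> * seminorm_L1 \<rho> u"
proof -
  obtain f where f: "integrable lborel f" "u = abs_L1 f" by (rule borel_representative)
  then show ?thesis
    using seminorm_eq_variation[of "\<lambda>x. c * f x"] variation_scale[of f c] borel_measurable_integrable[OF f(1)]
    by (simp add: scaleR_abs_L1 integrable_lebesgueI seminorm_eq_variation)
qed

lemma seminorm_zero: "seminorm_L1 \<rho> 0 = 0"
  using seminorm_scale[of 0 0] by simp

lemma seminorm_minus: "seminorm_L1 \<rho> (- u) = seminorm_L1 \<rho> u"
  using seminorm_scale[of "- 1" u] by simp

text \<open>
  The whole space is its only \<open>\<epsilon>\<close>-component, and it has infinite measure.
\<close>

lemma seminorm_eq_0_imp: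
  assumes "seminorm_L1 \<rho> u = 0"
  shows "u = 0"
proof -
  obtain f where f: "integrable lborel f" "u = abs_L1 f" by (rule borel_representative)
  then have "AE p in interaction \<rho>. f (fst p) = f (snd p)"
    using assms borel_measurable_integrable[OF f(1)]
    by (simp add: seminorm_eq_variation variation_eq_0_iff)
  then have "AE x in lebesgue. x \<in> UNIV \<longrightarrow> f x = 0"
    by (intro AE_zero_if_locally_constant[OF f(1)])
      (auto simp: eps_component_UNIV[OF eps] elim: eventually_mono)
  then have "abs_L1 f = abs_L1 (\<lambda>x. 0)"
    by (subst abs_L1_eq_iff) (auto intro: integrable_lebesgueI f)
  then show ?thesis by (simp add: f zero_L1_def)
qed

lemma mem_W_unit_ball: "u \<in> W_unit_ball \<rho> \<longleftrightarrow> seminorm_L1 \<rho> u \<le> 1"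
  by (auto simp: W_unit_ball_def W_space_def intro: le_less_trans)

lemma perimeter_eq_seminorm:
  assumes "E \<in> sets lebesgue" "emeasure lebesgue E < \<infinity>"
  shows "perimeter \<rho> E = seminorm_L1 \<rho> (abs_L1 (indicat_real E))"
  using assms by (simp add: perimeter_def seminorm_abs_L1)

lemma perimeter_eq_variation:
  assumes E: "E \<in> sets lebesgue" "emeasure lebesgue E < \<infinity>"
    and E': "E' \<in> sets borel" and ae: "AE x in lebesgue. x \<in> E' \<longleftrightarrow> x \<in> E"
  shows "perimeter \<rho> E = variation \<rho> (indicat_real E')"
proof -
  have "emeasure lebesgue E' = emeasure lebesgue E"
    using ae E E' by (intro emeasure_eq_AE) auto
  then have int: "integrable lborel (indicat_real E')" using E E' by simp
  have "AE x in lebesgue. indicat_real E x = indicat_real E' x"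
    using ae by eventually_elim (auto split: split_indicator)
  then have "abs_L1 (indicat_real E) = abs_L1 (indicat_real E')"
    using E int by (subst abs_L1_eq_iff) (auto intro: integrable_lebesgueI)
  then show ?thesis
    using perimeter_eq_seminorm[OF E] seminorm_eq_variation[OF int] by simp
qed

section \<open>Extreme points are multiples of indicator functions\<close>

text \<open>
  A nonzero point of norm less than \<open>1\<close> lies between \<open>0\<close> and its normalisation.  The point \<open>0\<close> is the midpoint
  of two opposite points, provided that the space is nontrivial.
\<close>

lemma extreme_seminorm_eq_1:
  assumes ext: "u extreme_point_of W_unit_ball \<rho>" and nontrivial: "W_space \<rho> \<noteq> {0}"
  shows "seminorm_L1 \<rho> u = 1"
proof (rule ccontr)
  have le: "seminorm_L1 \<rho> u \<le> 1"
    using ext by (simp add: extreme_point_of_def mem_W_unit_ball)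
  have notin: "u \<notin> open_segment a b" if "seminorm_L1 \<rho> a \<le> 1" "seminorm_L1 \<rho> b \<le> 1" for a b
    using ext that by (simp add: extreme_point_of_def mem_W_unit_ball)
  assume "seminorm_L1 \<rho> u \<noteq> 1"
  define s where "s = enn2real (seminorm_L1 \<rho> u)"
  have s: "seminorm_L1 \<rho> u = ennreal s"
    using le by (simp add: s_def ennreal_enn2real_if) (metis ennreal_one_less_top leD top.not_eq_extremum)
  have s1: "0 \<le> s" "s < 1"
    using le \<open>seminorm_L1 \<rho> u \<noteq> 1\<close> unfolding s
    by (auto simp: s_def less_le)
  show False
  proof (cases "u = 0")
    case True
    have "0 \<in> W_space \<rho>" by (simp add: W_space_def seminorm_zero)
    (* 0 is the midpoint of w and - w for a nonzero w in the ball *)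
    then obtain v where v: "v \<in> W_space \<rho>" "v \<noteq> 0" using nontrivial by blast
    define n where "n = enn2real (seminorm_L1 \<rho> v)"
    have n: "seminorm_L1 \<rho> v = ennreal n" "n \<ge> 0" using v(1) by (simp_all add: W_space_def n_def)
    define w where "w = (1 / (1 + n)) *\<^sub>R v"
    have "seminorm_L1 \<rho> w = ennreal (n / (1 + n))"
      using n(2) by (simp add: w_def seminorm_scale n(1) ennreal_mult'[symmetric])
    also have "\<dots> \<le> 1" using n(2) by (simp add: divide_le_eq)
    finally have "u \<notin> open_segment w (- w)" by (intro notin) (simp_all add: seminorm_minus)
    moreover have "w \<noteq> 0" using v(2) n(2) by (simp add: w_def)
    then have "w \<noteq> - w"
      by (metis add.right_inverse scaleR_2 scaleR_eq_0_iff zero_neq_numeral)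
    then have "0 \<in> open_segment w (- w)"
      unfolding in_segment by (intro conjI exI[of _ "1/2"]) simp_all
    ultimately show False using True by simp
  next
    case False
    then have "s \<noteq> 0" using seminorm_eq_0_imp[of u] s by auto
    then have "s > 0" using s1 by simp
    have "seminorm_L1 \<rho> ((1 / s) *\<^sub>R u) = 1"
      using \<open>s > 0\<close> by (simp add: seminorm_scale s ennreal_mult'[symmetric])
    then have "u \<notin> open_segment 0 ((1 / s) *\<^sub>R u)" by (intro notin) (simp_all add: seminorm_zero)
    moreover have "u \<in> open_segment 0 ((1 / s) *\<^sub>R u)"
      unfolding in_segment using \<open>s > 0\<close> s1 False by (intro conjI exI[of _ s]) auto
    ultimately show False by blast
  qed
qed

text \<open>
  Otherwise \<open>u\<close> would be a proper convex combination of the normalisations of \<open>v\<close> and \<open>w\<close>, with their norms as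
  weights.
\<close>

lemma extreme_split:
  assumes ext: "u extreme_point_of W_unit_ball \<rho>" and one: "seminorm_L1 \<rho> u = 1"
    and uvw: "u = v + w" and add: "seminorm_L1 \<rho> v + seminorm_L1 \<rho> w = seminorm_L1 \<rho> u"
  shows "\<exists>\<alpha>. v = \<alpha> *\<^sub>R u"
proof -
  define \<alpha> \<beta> where "\<alpha> = enn2real (seminorm_L1 \<rho> v)" and "\<beta> = enn2real (seminorm_L1 \<rho> w)"
  have "seminorm_L1 \<rho> v \<noteq> top" "seminorm_L1 \<rho> w \<noteq> top"
    using add one by auto
  then have \<alpha>: "seminorm_L1 \<rho> v = ennreal \<alpha>" and \<beta>: "seminorm_L1 \<rho> w = ennreal \<beta>"
    by (simp_all add: \<alpha>_def \<beta>_def less_top)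
  have nn: "\<alpha> \<ge> 0" "\<beta> \<ge> 0" by (simp_all add: \<alpha>_def \<beta>_def)
  have sum: "\<alpha> + \<beta> = 1"
    using add nn unfolding one \<alpha> \<beta> by (simp add: ennreal_plus[symmetric] del: ennreal_plus)
  consider "\<alpha> = 0" | "\<beta> = 0" | "\<alpha> > 0" "\<beta> > 0" using nn by linarith
  then show ?thesis
  proof cases
    case 1
    then show ?thesis using seminorm_eq_0_imp[of v] \<alpha> by auto
  next
    case 2
    then have "v = 1 *\<^sub>R u" using seminorm_eq_0_imp[of w] \<beta> uvw by simp
    then show ?thesis ..
  next
    case 3
    let ?a = "(1 / \<alpha>) *\<^sub>R v" and ?b = "(1 / \<beta>) *\<^sub>R w"
    have "seminorm_L1 \<rho> ?a = 1" "seminorm_L1 \<rho> ?b = 1"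
      using 3 by (simp_all add: seminorm_scale \<alpha> \<beta> ennreal_mult'[symmetric])
    then have "u \<notin> open_segment ?a ?b"
      using ext by (simp add: extreme_point_of_def mem_W_unit_ball)
    moreover have u: "u = (1 - \<beta>) *\<^sub>R ?a + \<beta> *\<^sub>R ?b"
      using 3 sum uvw by (simp add: eq_diff_eq[symmetric])
    moreover have "0 < \<beta>" "\<beta> < 1" using 3 sum by simp_all
    ultimately have "?a = ?b" unfolding in_segment by blast
    with u have "u = (1 - \<beta>) *\<^sub>R ?a + \<beta> *\<^sub>R ?a" by (simp only:)
    also have "\<dots> = ?a" by (simp only: scaleR_left_distrib[symmetric]) simp
    finally have "u = ?a" .
    then have "v = \<alpha> *\<^sub>R u" using 3 by simp
    then show ?thesis ..
  qed
qed

lemma extreme_split_functions: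
  assumes ext: "u extreme_point_of W_unit_ball \<rho>" and one: "seminorm_L1 \<rho> u = 1"
    and f: "integrable lborel f" and g: "integrable lborel g"
    and u: "u = abs_L1 (\<lambda>x. f x + g x)"
    and add: "AE p in interaction \<rho>. \<bar>(f (fst p) + g (fst p)) - (f (snd p) + g (snd p))\<bar> =
      \<bar>f (fst p) - f (snd p)\<bar> + \<bar>g (fst p) - g (snd p)\<bar>"
  shows "\<exists>\<alpha>. AE x in lebesgue. f x = \<alpha> * (f x + g x)"
proof -
  have fg: "integrable lborel (\<lambda>x. f x + g x)" using f g by simp
  have "\<exists>\<alpha>. abs_L1 f = \<alpha> *\<^sub>R u"
  proof (rule extreme_split[OF ext one])
    show "u = abs_L1 f + abs_L1 g"
      using f g by (simp add: plus_abs_L1 integrable_lebesgueI u)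
    show "seminorm_L1 \<rho> (abs_L1 f) + seminorm_L1 \<rho> (abs_L1 g) = seminorm_L1 \<rho> u"
      unfolding u seminorm_eq_variation[OF f] seminorm_eq_variation[OF g] seminorm_eq_variation[OF fg]
      using borel_measurable_integrable[OF f] borel_measurable_integrable[OF g] add
      by (intro variation_add[symmetric]) simp_all
  qed
  then obtain \<alpha> where "abs_L1 f = abs_L1 (\<lambda>x. \<alpha> * (f x + g x))"
    unfolding u using fg by (auto simp: scaleR_abs_L1 integrable_lebesgueI)
  then have "AE x in lebesgue. f x = \<alpha> * (f x + g x)"
    using f fg by (subst (asm) abs_L1_eq_iff) (simp_all add: integrable_lebesgueI)
  then show ?thesis ..
qed

text \<open>
  Clipping \<open>f\<close> to \<open>{s..t}\<close> with \<open>s \<le> 0 \<le> t\<close> keeps it integrable, and both the clipped function and the remainder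
  are nondecreasing functions of \<open>f\<close>.  Hence their variations add up to that of \<open>f\<close>, every clipping of \<open>f\<close> is
  proportional to \<open>f\<close>, and \<open>f\<close> takes a single nonzero value.
\<close>

lemma extreme_imp_indicator:
  assumes ext: "u extreme_point_of W_unit_ball \<rho>" and one: "seminorm_L1 \<rho> u = 1"
  obtains c E where "c \<noteq> 0" "E \<in> sets borel" "0 < emeasure lborel E" "emeasure lborel E < \<infinity>"
    "u = c *\<^sub>R abs_L1 (indicat_real E)"
proof -
  obtain f where f: "integrable lborel f" "u = abs_L1 f" by (rule borel_representative)
  note [measurable] = borel_measurable_integrable[OF f(1)]
  have "\<exists>\<alpha>. AE x in lebesgue. max s (min t (f x)) = \<alpha> * f x" if st: "s \<le> 0" "0 \<le> t" for s t
  proof -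
    let ?c = "\<lambda>x. max s (min t (f x))"
    have c: "integrable lborel ?c"
      by (rule Bochner_Integration.integrable_bound[OF f(1)])
        (use st in \<open>auto intro!: always_eventually simp: max_def min_def\<close>)
    have "\<exists>\<alpha>. AE x in lebesgue. ?c x = \<alpha> * (?c x + (f x - ?c x))"
    proof (rule extreme_split_functions[OF ext one])
      show "AE p in interaction \<rho>. \<bar>(?c (fst p) + (f (fst p) - ?c (fst p))) - (?c (snd p) + (f (snd p) - ?c (snd p)))\<bar> =
        \<bar>?c (fst p) - ?c (snd p)\<bar> + \<bar>(f (fst p) - ?c (fst p)) - (f (snd p) - ?c (snd p))\<bar>"
        using st by (intro always_eventually) (auto simp: max_def min_def)
    qed (use f c in auto)
    then show ?thesis by simp
  qed
  (* Rational levels suffice and let the exceptional null sets be united. *)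
  then obtain \<alpha> where "AE x in lebesgue. max s (min t (f x)) = \<alpha> s t * f x" if "s \<le> 0" "0 \<le> t" for s t
    by metis
  then have "AE x in lebesgue. \<forall>s\<in>{s \<in> \<rat>. s \<le> 0}. \<forall>t\<in>{t \<in> \<rat>. 0 \<le> t}. max s (min t (f x)) = \<alpha> s t * f x"
    by (intro AE_ball_countable' countable_Collect countable_rat) auto
  then have good: "AE x in lebesgue. \<forall>s t. s \<in> \<rat> \<longrightarrow> t \<in> \<rat> \<longrightarrow> s \<le> 0 \<longrightarrow> 0 \<le> t \<longrightarrow> max s (min t (f x)) = \<alpha> s t * f x"
    (is "AE x in lebesgue. ?G x") by eventually_elim blast
  have "\<not> (AE x in lebesgue. f x = 0)"
  proof
    assume "AE x in lebesgue. f x = 0"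
    then have "u = 0" using f abs_L1_eq_iff[of f "\<lambda>x. 0"] by (simp add: zero_L1_def integrable_lebesgueI)
    then show False using one seminorm_zero by simp
  qed
  moreover have "AE x in lebesgue. f x = 0" if no: "\<nexists>x. ?G x \<and> f x \<noteq> 0"
    using good by (rule eventually_mono) (use no in blast)
  ultimately obtain x0 where x0: "?G x0" "f x0 \<noteq> 0" by blast
  define E where "E = {x. f x = f x0}"
  have E: "E \<in> sets borel" unfolding E_def by measurable
  have E_fin: "emeasure lborel E < \<infinity>"
    by (rule emeasure_finite_if_bounded_below[OF f(1) E, where t = "\<bar>f x0\<bar>"]) (use x0(2) in \<open>simp_all add: E_def\<close>)
  have "AE x in lebesgue. f x = f x0 * indicat_real E x"
    using good
  proof eventually_elim
    case (elim x)
    have "f x = f x0" if "f x \<noteq> 0"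
    proof (rule ccontr)
      assume "f x \<noteq> f x0"
      then consider "f x < f x0" | "f x0 < f x" by linarith
      then show False
      proof cases
        case 1
        show False by (rule clip_proportional[of "f x" "f x0" \<alpha>, OF _ 1 that x0(2)]) (use elim x0(1) in blast)
      next
        case 2
        show False by (rule clip_proportional[of "f x0" "f x" \<alpha>, OF _ 2 x0(2) that]) (use elim x0(1) in blast)
      qed
    qed
    then show ?case by (auto simp: E_def split: split_indicator)
  qed
  moreover have indE: "integrable lebesgue (indicat_real E)"
    using E E_fin by (intro integrable_lebesgueI) auto
  ultimately have u: "u = f x0 *\<^sub>R abs_L1 (indicat_real E)"
    using f by (simp add: scaleR_abs_L1 abs_L1_eq_iff integrable_lebesgueI)
  have "emeasure lborel E \<noteq> 0"
  proof
    assume "emeasure lborel E = 0"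
    then have "AE x in lebesgue. x \<notin> E"
      using E by (intro AE_completion AE_not_in) auto
    then have "AE x in lebesgue. indicat_real E x = 0" by eventually_elim simp
    then have "abs_L1 (indicat_real E) = 0"
      using abs_L1_eq_iff[OF indE, of "\<lambda>x. 0"] by (simp add: zero_L1_def)
    then show False using one u seminorm_zero by simp
  qed
  with that[OF x0(2) E _ E_fin u] show ?thesis by (simp add: zero_less_iff_neq_zero)
qed

section \<open>Extreme points come from simple sets\<close>

text \<open>
  In a decomposition of \<open>E\<close> the indicator of one part would be a multiple of the indicator of \<open>E\<close>.
\<close>

lemma extreme_imp_indecomposable:
  assumes ext: "u extreme_point_of W_unit_ball \<rho>" and one: "seminorm_L1 \<rho> u = 1"
    and E: "E \<in> sets lebesgue" "emeasure lebesgue E < \<infinity>"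
    and u: "u = c *\<^sub>R abs_L1 (indicat_real E)" and c: "c \<noteq> 0"
  shows "indecomposable \<rho> E"
proof -
  have per: "ennreal \<bar>c\<bar> * perimeter \<rho> E = 1"
    using one by (simp add: u seminorm_scale perimeter_eq_seminorm[OF E])
  then have fin: "perimeter \<rho> E < \<infinity>"
    using ennreal_mult_eq_1D by simp
  have "\<not> decomposable \<rho> E"
  proof
    assume "decomposable \<rho> E"
    then obtain E1 E2 where m: "E1 \<in> sets lebesgue" "E2 \<in> sets lebesgue"
      and part: "E1 \<union> E2 = E" "E1 \<inter> E2 = {}"
      and pos: "emeasure lebesgue E1 > 0" "emeasure lebesgue E2 > 0"
      and add: "perimeter \<rho> E = perimeter \<rho> E1 + perimeter \<rho> E2"
      unfolding decomposable_def by blast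
    have fin12: "emeasure lebesgue E1 < \<infinity>" "emeasure lebesgue E2 < \<infinity>"
      using E part(1) by (auto intro: le_less_trans[OF emeasure_mono])
    have int: "integrable lebesgue (indicat_real E1)" "integrable lebesgue (indicat_real E2)"
      "integrable lebesgue (indicat_real E)"
      using m fin12 E by auto
    have "indicat_real E = (\<lambda>x. indicat_real E1 x + indicat_real E2 x)"
      using part by (auto simp: fun_eq_iff split: split_indicator)
    then have sum: "u = c *\<^sub>R abs_L1 (indicat_real E1) + c *\<^sub>R abs_L1 (indicat_real E2)"
      using int by (simp add: u scaleR_right_distrib[symmetric] plus_abs_L1)
    have "\<exists>\<alpha>. c *\<^sub>R abs_L1 (indicat_real E1) = \<alpha> *\<^sub>R u"
    proof (rule extreme_split[OF ext one sum])
      show "seminorm_L1 \<rho> (c *\<^sub>R abs_L1 (indicat_real E1)) + seminorm_L1 \<rho> (c *\<^sub>R abs_L1 (indicat_real E2)) =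
          seminorm_L1 \<rho> u"
        using add E m fin12
        by (simp add: u seminorm_scale perimeter_eq_seminorm[symmetric] distrib_left)
    qed
    then obtain \<alpha> where "c *\<^sub>R abs_L1 (indicat_real E1) = c *\<^sub>R (\<alpha> *\<^sub>R abs_L1 (indicat_real E))"
      by (auto simp: u mult.commute)
    then have "abs_L1 (indicat_real E1) = \<alpha> *\<^sub>R abs_L1 (indicat_real E)"
      using c by (simp only: scaleR_cancel_left) simp
    then have "abs_L1 (indicat_real E1) = abs_L1 (\<lambda>x. \<alpha> * indicat_real E x)"
      using int by (simp add: scaleR_abs_L1)
    then have ae: "AE x in lebesgue. indicat_real E1 x = \<alpha> * indicat_real E x"
      using int by (simp add: abs_L1_eq_iff)
    show False
    proof (cases "\<alpha> = 1")
      case True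
      from ae have "AE x in lebesgue. x \<notin> E2"
        by eventually_elim (use part True in \<open>auto split: split_indicator_asm\<close>)
      then show False using emeasure_pos_iff_not_AE[OF m(2)] pos by simp
    next
      case False
      from ae have "AE x in lebesgue. x \<notin> E1"
        by eventually_elim (use part False in \<open>auto split: split_indicator_asm\<close>)
      then show False using emeasure_pos_iff_not_AE[OF m(1)] pos by simp
    qed
  qed
  with E fin show ?thesis by (simp add: indecomposable_def)
qed

text \<open>
  A component \<open>C\<close> of finite measure does not interact with the rest of the complement.  Hence each
  interacting pair that \<open>E\<close> separates is separated by exactly one of \<open>E \<union> C\<close> and \<open>C\<close>, and no other interacting
  pair is separated by either.  As \<open>1\<^sub>E\<close> is the difference of their indicator functions, extremality would make
  the indicator function of \<open>E \<union> C\<close> a multiple of \<open>1\<^sub>E\<close>.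
\<close>

lemma extreme_imp_no_finite_component:
  assumes ext: "u extreme_point_of W_unit_ball \<rho>" and one: "seminorm_L1 \<rho> u = 1"
    and E: "E \<in> sets borel" "emeasure lborel E < \<infinity>"
    and u: "u = c *\<^sub>R abs_L1 (indicat_real E)" and c: "c \<noteq> 0"
    and x: "x \<in> density_points (- E)"
  shows "emeasure lebesgue (eps_component \<epsilon> (- E) x) = \<infinity>"
proof (rule ccontr)
  define C where "C = eps_component \<epsilon> (- E) x"
  assume "emeasure lebesgue (eps_component \<epsilon> (- E) x) \<noteq> \<infinity>"
  then have C_fin: "emeasure lebesgue C < \<infinity>" by (simp add: C_def less_top)
  have Em: "- E \<in> sets lebesgue" using E by (intro sets_completionI_sets) auto
  have C: "C \<in> sets lebesgue" unfolding C_def by (rule eps_component_sets[OF Em eps])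
  obtain C' where C': "C' \<in> sets borel" "AE x in lebesgue. x \<in> C' \<longleftrightarrow> x \<in> C"
    using lebesgue_set_borel_version[OF C] by blast
  (* Borel version of C that is disjoint from E not only almost everywhere *)
  define D where "D = C' - E"
  have D: "D \<in> sets borel" unfolding D_def using C' E by auto
  have D_eq: "AE x in lebesgue. x \<in> D \<longleftrightarrow> x \<in> C"
    using C'(2) AE_density_points_iff[OF Em]
    by eventually_elim (auto simp: D_def C_def eps_component_def)
  have "emeasure lebesgue D = emeasure lebesgue C"
    using D_eq D C by (intro emeasure_eq_AE) auto
  then have D_fin: "emeasure lborel D < \<infinity>" using C_fin D by simp
  have "AE x in lborel. x \<in> D \<longleftrightarrow> x \<in> C" "AE x in lborel. x \<in> - E \<longrightarrow> x \<in> density_points (- E)"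
    using D_eq AE_density_point[OF Em] by (simp_all add: AE_completion_iff)
  note AE_pair_fst[OF this(1)] AE_pair_snd[OF this(1)] AE_pair_snd[OF this(2)]
  then have "AE p in lborel2. norm (fst p - snd p) < \<epsilon> \<longrightarrow> \<not> (fst p \<in> D \<and> snd p \<in> - E - D)"
  proof eventually_elim
    case (elim p)
    show ?case
      using elim eps_component_step[of "fst p" \<epsilon> "- E" x "snd p"] by (auto simp: C_def)
  qed
  then have sep: "AE p in interaction \<rho>. \<not> (fst p \<in> D \<and> snd p \<in> - E - D)"
    by (rule AE_interaction_near)
  have sep': "AE p in interaction \<rho>. \<not> (fst p \<in> - E - D \<and> snd p \<in> D)"
    by (rule AE_interaction_rectangle_swap[OF D _ sep]) (use D E in auto)
  let ?f = "\<lambda>x. c * indicat_real (E \<union> D) x" and ?g = "\<lambda>x. - c * indicat_real D x"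
  have "emeasure lborel (E \<union> D) \<le> emeasure lborel E + emeasure lborel D"
    by (rule emeasure_subadditive) (use E D in auto)
  also have "\<dots> < \<infinity>" using E(2) D_fin by simp
  finally have int: "integrable lborel ?f" "integrable lborel ?g"
    using E D D_fin by auto
  have disj: "E \<inter> D = {}" by (auto simp: D_def)
  then have fg: "?f x + ?g x = c * indicat_real E x" for x
    by (auto split: split_indicator)
  have "\<exists>\<alpha>. AE x in lebesgue. ?f x = \<alpha> * (?f x + ?g x)"
  proof (rule extreme_split_functions[OF ext one int])
    show "u = abs_L1 (\<lambda>x. ?f x + ?g x)"
      unfolding fg u using E by (intro scaleR_abs_L1) auto
    show "AE p in interaction \<rho>. \<bar>?f (fst p) + ?g (fst p) - (?f (snd p) + ?g (snd p))\<bar> =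
      \<bar>?f (fst p) - ?f (snd p)\<bar> + \<bar>?g (fst p) - ?g (snd p)\<bar>"
      using sep sep' by eventually_elim (use disj in \<open>auto split: split_indicator\<close>)
  qed
  then obtain \<alpha> where "AE x in lebesgue. ?f x = \<alpha> * (c * indicat_real E x)"
    unfolding fg by blast
  with D_eq have "AE x in lebesgue. x \<notin> C"
    by eventually_elim (use disj c in \<open>auto split: split_indicator_asm\<close>)
  then show False
    using eps_component_not_null[OF Em eps x] by (simp add: C_def)
qed

section \<open>Rigidity of simple sets\<close>

text \<open>
  For a partition into two sets that do not interact, the perimeters add up, so that one of the parts must be null.
\<close>

lemma indecomposable_no_splitting:
  assumes ind: "indecomposable \<rho> E" and fin: "emeasure lebesgue E < \<infinity>"
    and E': "E' \<in> sets borel" "AE x in lebesgue. x \<in> E' \<longleftrightarrow> x \<in> E"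
    and S: "S \<in> sets borel"
    and null: "AE p in interaction \<rho>. \<not> (fst p \<in> E' \<inter> S \<and> snd p \<in> E' - S)"
  shows "(AE x in lebesgue. x \<in> E' \<longrightarrow> x \<in> S) \<or> (AE x in lebesgue. x \<in> E' \<longrightarrow> x \<notin> S)"
proof (rule ccontr)
  assume contr: "\<not> ?thesis"
  have E: "E \<in> sets lebesgue" and P: "perimeter \<rho> E < \<infinity>" and nd: "\<not> decomposable \<rho> E"
    using ind by (auto simp: indecomposable_def)
  have SL: "S \<in> sets lebesgue" using S by simp
  have m: "E \<inter> S \<in> sets lebesgue" "E - S \<in> sets lebesgue" using E SL by auto
  have fin12: "emeasure lebesgue (E \<inter> S) < \<infinity>" "emeasure lebesgue (E - S) < \<infinity>"
    using E fin by (auto intro: le_less_trans[OF emeasure_mono])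
  have m': "E' \<inter> S \<in> sets borel" "E' - S \<in> sets borel" using E' S by auto
  have swap: "AE p in interaction \<rho>. \<not> (fst p \<in> E' - S \<and> snd p \<in> E' \<inter> S)"
    by (rule AE_interaction_rectangle_swap[OF m' null])
  have "variation \<rho> (indicat_real E') = variation \<rho> (\<lambda>x. indicat_real (E' \<inter> S) x + indicat_real (E' - S) x)"
    by (intro arg_cong[where f = "variation \<rho>"]) (auto simp: fun_eq_iff split: split_indicator)
  also have "\<dots> = variation \<rho> (indicat_real (E' \<inter> S)) + variation \<rho> (indicat_real (E' - S))"
  proof (rule variation_add)
    show "AE p in interaction \<rho>.
      \<bar>indicat_real (E' \<inter> S) (fst p) + indicat_real (E' - S) (fst p) -
        (indicat_real (E' \<inter> S) (snd p) + indicat_real (E' - S) (snd p))\<bar> =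
      \<bar>indicat_real (E' \<inter> S) (fst p) - indicat_real (E' \<inter> S) (snd p)\<bar> +
      \<bar>indicat_real (E' - S) (fst p) - indicat_real (E' - S) (snd p)\<bar>"
      using null swap by eventually_elim (auto split: split_indicator)
  qed (use m' in auto)
  also have "variation \<rho> (indicat_real (E' \<inter> S)) = perimeter \<rho> (E \<inter> S)"
    using E'(2) by (intro perimeter_eq_variation[symmetric] m fin12 m') (auto elim: eventually_mono)
  also have "variation \<rho> (indicat_real (E' - S)) = perimeter \<rho> (E - S)"
    using E'(2) by (intro perimeter_eq_variation[symmetric] m fin12 m') (auto elim: eventually_mono)
  also have "variation \<rho> (indicat_real E') = perimeter \<rho> E"
    by (rule perimeter_eq_variation[OF E fin E', symmetric])
  finally have add: "perimeter \<rho> E = perimeter \<rho> (E \<inter> S) + perimeter \<rho> (E - S)" .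
  have "\<not> (AE x in lebesgue. x \<notin> E \<inter> S)"
  proof
    assume "AE x in lebesgue. x \<notin> E \<inter> S"
    with E'(2) have "AE x in lebesgue. x \<in> E' \<longrightarrow> x \<notin> S" by eventually_elim auto
    then show False using contr by blast
  qed
  moreover have "\<not> (AE x in lebesgue. x \<notin> E - S)"
  proof
    assume "AE x in lebesgue. x \<notin> E - S"
    with E'(2) have "AE x in lebesgue. x \<in> E' \<longrightarrow> x \<in> S" by eventually_elim auto
    then show False using contr by blast
  qed
  ultimately have "decomposable \<rho> E"
    unfolding decomposable_def
    using E P add m emeasure_pos_iff_not_AE[OF m(1)] emeasure_pos_iff_not_AE[OF m(2)]
    by (intro conjI exI[of _ "E \<inter> S"] exI[of _ "E - S"]) (auto simp: less_top)
  then show False using nd by blast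
qed

text \<open>
  Every superlevel set of \<open>f\<close> is null or of full measure in \<open>E'\<close>; the rational levels determine the value.
\<close>

lemma indecomposable_AE_const:
  fixes f :: "'a \<Rightarrow> real"
  assumes ind: "indecomposable \<rho> E" and fin: "emeasure lebesgue E < \<infinity>"
    and E': "E' \<in> sets borel" "AE x in lebesgue. x \<in> E' \<longleftrightarrow> x \<in> E"
    and f [measurable]: "f \<in> borel_measurable borel"
    and const: "AE p in interaction \<rho>. fst p \<in> E' \<and> snd p \<in> E' \<longrightarrow> f (fst p) = f (snd p)"
  shows "\<exists>\<kappa>. AE x in lebesgue. x \<in> E' \<longrightarrow> f x = \<kappa>"
proof -
  have "\<exists>T. AE x in lebesgue. x \<in> E' \<longrightarrow> (s < f x \<longleftrightarrow> T)" for s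
  proof -
    have S: "{x. s < f x} \<in> sets borel" by measurable
    have "AE p in interaction \<rho>. \<not> (fst p \<in> E' \<inter> {x. s < f x} \<and> snd p \<in> E' - {x. s < f x})"
      using const by eventually_elim auto
    from indecomposable_no_splitting[OF ind fin E' S this] show ?thesis
      by (auto intro: exI[of _ True] exI[of _ False])
  qed
  then obtain T where "\<And>s. AE x in lebesgue. x \<in> E' \<longrightarrow> (s < f x \<longleftrightarrow> T s)" by metis
  then have "AE x in lebesgue. \<forall>s\<in>\<rat>. x \<in> E' \<longrightarrow> (s < f x \<longleftrightarrow> T s)"
    by (intro AE_ball_countable' countable_rat) auto
  then have good: "AE x in lebesgue. x \<in> E' \<longrightarrow> (\<forall>s\<in>\<rat>. s < f x \<longleftrightarrow> T s)"
    by eventually_elim blast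
  show ?thesis
  proof (cases "\<exists>x0. x0 \<in> E' \<and> (\<forall>s\<in>\<rat>. s < f x0 \<longleftrightarrow> T s)")
    case True
    then obtain x0 where x0: "\<And>s. s \<in> \<rat> \<Longrightarrow> s < f x0 \<longleftrightarrow> T s" by blast
    have "AE x in lebesgue. x \<in> E' \<longrightarrow> f x = f x0"
    proof (rule eventually_mono[OF good], intro impI, rule ccontr)
      fix x assume "x \<in> E' \<longrightarrow> (\<forall>s\<in>\<rat>. s < f x \<longleftrightarrow> T s)" "x \<in> E'" and ne: "f x \<noteq> f x0"
      then have x: "s < f x \<longleftrightarrow> s < f x0" if "s \<in> \<rat>" for s using that x0 by blast
      consider "f x < f x0" | "f x0 < f x" using ne by linarith
      then show False
      proof cases
        case 1
        then obtain s where "s \<in> \<rat>" "f x < s" "s < f x0" using Rats_dense_in_real by blast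
        then show False using x[of s] by simp
      next
        case 2
        then obtain s where "s \<in> \<rat>" "f x0 < s" "s < f x" using Rats_dense_in_real by blast
        then show False using x[of s] by simp
      qed
    qed
    then show ?thesis ..
  next
    case False
    from good have "AE x in lebesgue. x \<in> E' \<longrightarrow> f x = 0"
      by (rule eventually_mono) (use False in blast)
    then show ?thesis ..
  qed
qed

text \<open>
  Indecomposability controls \<open>f\<close> on \<open>E\<close>, the components of the complement control it outside.
\<close>

lemma simple_rigidity:
  fixes f :: "'a \<Rightarrow> real"
  assumes simple: "simple_set \<epsilon> \<rho> E"
    and E': "E' \<in> sets borel" "AE x in lebesgue. x \<in> E' \<longleftrightarrow> x \<in> E"
    and f: "integrable lborel f"
    and const: "AE p in interaction \<rho>. (fst p \<in> E' \<longleftrightarrow> snd p \<in> E') \<longrightarrow> f (fst p) = f (snd p)"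
  shows "\<exists>\<kappa>. abs_L1 f = \<kappa> *\<^sub>R abs_L1 (indicat_real E)"
proof -
  have fin: "emeasure lebesgue E < \<infinity>" and ind: "indecomposable \<rho> E"
    and comp: "\<not> (\<exists>x\<in>density_points (- E). emeasure lebesgue (eps_component \<epsilon> (- E) x) < \<infinity>)"
    using simple by (auto simp: simple_set_def)
  have E: "E \<in> sets lebesgue" using ind by (simp add: indecomposable_def)
  have dens: "density_points (- E) = density_points (- E')"
  proof (rule density_points_cong)
    show "- E \<in> sets lebesgue" using E by (rule Compl_in_sets_lebesgue[THEN iffD2])
    show "- E' \<in> sets lebesgue" using E'(1) by (intro sets_completionI_sets) auto
    show "AE x in lebesgue. x \<in> - E \<longleftrightarrow> x \<in> - E'" using E'(2) by eventually_elim auto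
  qed
  have "AE p in interaction \<rho>. fst p \<in> E' \<and> snd p \<in> E' \<longrightarrow> f (fst p) = f (snd p)"
    using const by eventually_elim auto
  from indecomposable_AE_const[OF ind fin E' _ this] borel_measurable_integrable[OF f]
  obtain \<kappa> where in_E: "AE x in lebesgue. x \<in> E' \<longrightarrow> f x = \<kappa>" by auto
  have "AE x in lebesgue. x \<in> - E' \<longrightarrow> f x = 0"
  proof (rule AE_zero_if_locally_constant[OF f])
    show "- E' \<in> sets borel" using E'(1) by auto
    show "AE p in interaction \<rho>. fst p \<in> - E' \<and> snd p \<in> - E' \<longrightarrow> f (fst p) = f (snd p)"
      using const by eventually_elim auto
    show "\<not> (\<exists>x\<in>density_points (- E'). emeasure lebesgue (eps_component \<epsilon> (- E') x) < \<infinity>)"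
      using comp unfolding dens eps_component_cong[OF dens] .
  qed
  with in_E E'(2) have "AE x in lebesgue. f x = \<kappa> * indicat_real E x"
    by eventually_elim (auto split: split_indicator)
  moreover have "integrable lebesgue (indicat_real E)" using E fin by simp
  ultimately have "abs_L1 f = \<kappa> *\<^sub>R abs_L1 (indicat_real E)"
    by (simp add: scaleR_abs_L1 abs_L1_eq_iff integrable_lebesgueI[OF f])
  then show ?thesis ..
qed

section \<open>Simple sets give extreme points\<close>

text \<open>
  By convexity of the absolute value the integrand for \<open>h\<close> is at most the convex combination \<open>\<phi>\<close> of the integrands
  for \<open>f\<close> and \<open>g\<close>.  Their integrals are \<open>1\<close> and at most \<open>1\<close>, so the integrands agree almost everywhere.
\<close>

lemma variation_convex_equality:
  assumes [measurable]: "f \<in> borel_measurable borel" "g \<in> borel_measurable borel" "h \<in> borel_measurable borel"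
    and t: "0 < t" "t < 1"
    and h: "AE x in lborel. h x = (1 - t) * f x + t * g x"
    and one: "variation \<rho> h = 1" and le: "variation \<rho> f \<le> 1" "variation \<rho> g \<le> 1"
  shows "AE p in interaction \<rho>. h (fst p) = h (snd p) \<longrightarrow> f (fst p) = f (snd p) \<and> g (fst p) = g (snd p)"
proof -
  define \<phi> where "\<phi> p = (1 - t) * \<bar>f (fst p) - f (snd p)\<bar> + t * \<bar>g (fst p) - g (snd p)\<bar>" for p
  define \<psi> where "\<psi> p = \<bar>h (fst p) - h (snd p)\<bar>" for p
  have [measurable]: "\<phi> \<in> borel_measurable (interaction \<rho>)" "\<psi> \<in> borel_measurable (interaction \<rho>)"
    unfolding \<phi>_def \<psi>_def by measurable
  have ae: "AE p in interaction \<rho>. \<psi> p \<le> \<phi> p"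
    using AE_interactionI[OF AE_pair_fst[OF h] meas] AE_interactionI[OF AE_pair_snd[OF h] meas]
  proof eventually_elim
    case (elim p)
    have "h (fst p) - h (snd p) = (1 - t) * (f (fst p) - f (snd p)) + t * (g (fst p) - g (snd p))"
      unfolding elim by (simp add: algebra_simps)
    also have "\<bar>\<dots>\<bar> \<le> \<phi> p"
      unfolding \<phi>_def using t by (intro order_trans[OF abs_triangle_ineq]) (simp add: abs_mult)
    finally show ?case by (simp add: \<psi>_def)
  qed
  (* The integral of \<psi> is 1, hence finite, and can be cancelled below. *)
  have "(\<integral>\<^sup>+p. ennreal (\<phi> p - \<psi> p) \<partial>interaction \<rho>) + 1 = (\<integral>\<^sup>+p. ennreal (\<phi> p - \<psi> p) + ennreal (\<psi> p) \<partial>interaction \<rho>)"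
    unfolding one[symmetric] variation_def by (subst nn_integral_add) (auto simp: \<psi>_def)
  also have "\<dots> = (\<integral>\<^sup>+p. ennreal (\<phi> p) \<partial>interaction \<rho>)"
  proof (rule nn_integral_cong_AE, use ae in eventually_elim)
    case (elim p)
    have "\<psi> p \<ge> 0" by (simp add: \<psi>_def)
    with elim show ?case by (simp add: ennreal_plus[symmetric] del: ennreal_plus)
  qed
  also have "\<dots> = ennreal (1 - t) * variation \<rho> f + ennreal t * variation \<rho> g"
    unfolding \<phi>_def variation_def using t
    by (subst (1 2) nn_integral_cmult[symmetric])
      (auto simp: ennreal_mult nn_integral_add[symmetric] intro!: nn_integral_cong)
  also have "\<dots> \<le> ennreal (1 - t) * 1 + ennreal t * 1"
    using le by (intro add_mono mult_left_mono) auto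
  also have "\<dots> = 1" using t by (simp add: ennreal_plus[symmetric] del: ennreal_plus)
  finally have "(\<integral>\<^sup>+p. ennreal (\<phi> p - \<psi> p) \<partial>interaction \<rho>) + 1 \<le> 0 + 1" by simp
  then have "(\<integral>\<^sup>+p. ennreal (\<phi> p - \<psi> p) \<partial>interaction \<rho>) = 0"
    using ennreal_add_left_cancel_le[of 1 "\<integral>\<^sup>+p. ennreal (\<phi> p - \<psi> p) \<partial>interaction \<rho>" 0]
    by (simp add: add.commute)
  then have "AE p in interaction \<rho>. ennreal (\<phi> p - \<psi> p) = 0"
    by (subst (asm) nn_integral_0_iff_AE) auto
  then show ?thesis
  proof eventually_elim
    case (elim p)
    show ?case
    proof
      assume "h (fst p) = h (snd p)"
      then have "\<phi> p \<le> 0" using elim by (simp add: \<psi>_def ennreal_eq_0_iff)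
      moreover have "(1 - t) * \<bar>f (fst p) - f (snd p)\<bar> \<ge> 0" "t * \<bar>g (fst p) - g (snd p)\<bar> \<ge> 0"
        using t by simp_all
      ultimately have "(1 - t) * \<bar>f (fst p) - f (snd p)\<bar> = 0" "t * \<bar>g (fst p) - g (snd p)\<bar> = 0"
        unfolding \<phi>_def by linarith+
      then show "f (fst p) = f (snd p) \<and> g (fst p) = g (snd p)" using t by simp
    qed
  qed
qed

text \<open>
  Both end points of a segment through \<open>c 1\<^sub>E\<close> are constant across the interacting pairs that \<open>E\<close> does not
  separate, hence multiples of \<open>1\<^sub>E\<close> by rigidity, with factors of modulus at most that of \<open>c\<close>.
\<close>

lemma simple_imp_extreme:
  assumes E: "E \<in> sets lebesgue" "emeasure lebesgue E < \<infinity>" and simple: "simple_set \<epsilon> \<rho> E"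
    and one: "ennreal \<bar>c\<bar> * perimeter \<rho> E = 1"
  shows "(c *\<^sub>R abs_L1 (indicat_real E)) extreme_point_of W_unit_ball \<rho>"
proof -
  define e where "e = abs_L1 (indicat_real E)"
  have Je: "seminorm_L1 \<rho> e = perimeter \<rho> E" by (simp add: e_def perimeter_eq_seminorm[OF E])
  have J: "seminorm_L1 \<rho> (\<kappa> *\<^sub>R e) = ennreal \<bar>\<kappa>\<bar> * perimeter \<rho> E" for \<kappa>
    by (simp add: seminorm_scale Je)
  have "e \<noteq> 0" using one Je seminorm_zero by auto
  have modulus: "\<bar>\<kappa>\<bar> \<le> \<bar>c\<bar>" if "seminorm_L1 \<rho> (\<kappa> *\<^sub>R e) \<le> 1" for \<kappa>
  proof (rule ccontr)
    assume "\<not> \<bar>\<kappa>\<bar> \<le> \<bar>c\<bar>"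
    then have "ennreal \<bar>c\<bar> < ennreal \<bar>\<kappa>\<bar>" by (simp add: ennreal_lessI)
    moreover have "0 < perimeter \<rho> E" "perimeter \<rho> E < top"
      using ennreal_mult_eq_1D[OF one] by simp_all
    ultimately have "ennreal \<bar>c\<bar> * perimeter \<rho> E < ennreal \<bar>\<kappa>\<bar> * perimeter \<rho> E"
      by (simp add: ennreal_mult_strict_right_mono)
    then show False using that unfolding one J by simp
  qed
  obtain E' where E': "E' \<in> sets borel" "AE x in lebesgue. x \<in> E' \<longleftrightarrow> x \<in> E"
    using lebesgue_set_borel_version[OF E(1)] by blast
  define h where "h x = c * indicat_real E' x" for x
  have "emeasure lebesgue E' = emeasure lebesgue E"
    using E' E by (intro emeasure_eq_AE) auto
  then have h_int: "integrable lborel h" unfolding h_def using E E' by simp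
  have ce: "c *\<^sub>R e = abs_L1 h"
  proof -
    have "AE x in lebesgue. c * indicat_real E x = h x"
      using E'(2) by eventually_elim (auto simp: h_def split: split_indicator)
    then show ?thesis
      using E h_int by (simp add: e_def scaleR_abs_L1 abs_L1_eq_iff integrable_lebesgueI)
  qed
  have "c *\<^sub>R e \<notin> open_segment a b" if ab: "a \<in> W_unit_ball \<rho>" "b \<in> W_unit_ball \<rho>" for a b
  proof
    assume "c *\<^sub>R e \<in> open_segment a b"
    then obtain t where "a \<noteq> b" and t: "0 < t" "t < 1" and comb: "c *\<^sub>R e = (1 - t) *\<^sub>R a + t *\<^sub>R b"
      by (auto simp: in_segment)
    obtain f where f: "integrable lborel f" "a = abs_L1 f" by (rule borel_representative)
    obtain g where g: "integrable lborel g" "b = abs_L1 g" by (rule borel_representative)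
    have "abs_L1 h = abs_L1 (\<lambda>x. (1 - t) * f x + t * g x)"
      using comb f g unfolding ce by (simp add: scaleR_abs_L1 plus_abs_L1 integrable_lebesgueI)
    then have "AE x in lborel. h x = (1 - t) * f x + t * g x"
      using f g h_int by (simp add: abs_L1_eq_iff integrable_lebesgueI AE_completion_iff)
    moreover have "variation \<rho> h = 1" "variation \<rho> f \<le> 1" "variation \<rho> g \<le> 1"
      using ab J[of c] one unfolding ce f g mem_W_unit_ball
      by (simp_all add: seminorm_eq_variation f(1) g(1) h_int)
    ultimately have ae: "AE p in interaction \<rho>. h (fst p) = h (snd p) \<longrightarrow>
        f (fst p) = f (snd p) \<and> g (fst p) = g (snd p)"
      using borel_measurable_integrable[OF f(1)] borel_measurable_integrable[OF g(1)]
        borel_measurable_integrable[OF h_int] t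
      by (intro variation_convex_equality) auto
    have "AE p in interaction \<rho>. (fst p \<in> E' \<longleftrightarrow> snd p \<in> E') \<longrightarrow> f (fst p) = f (snd p)"
      "AE p in interaction \<rho>. (fst p \<in> E' \<longleftrightarrow> snd p \<in> E') \<longrightarrow> g (fst p) = g (snd p)"
      using ae by (eventually_elim, auto simp: h_def split: split_indicator)+
    then obtain \<kappa> \<mu> where \<kappa>: "a = \<kappa> *\<^sub>R e" and \<mu>: "b = \<mu> *\<^sub>R e"
      using simple_rigidity[OF simple E' f(1)] simple_rigidity[OF simple E' g(1)]
      unfolding e_def f(2) g(2) by blast
    have "c *\<^sub>R e = ((1 - t) * \<kappa> + t * \<mu>) *\<^sub>R e"
      using comb by (simp add: \<kappa> \<mu> scaleR_left_distrib)
    then have c: "c = (1 - t) * \<kappa> + t * \<mu>" using \<open>e \<noteq> 0\<close> by simp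
    have "\<bar>\<kappa>\<bar> \<le> \<bar>c\<bar>" "\<bar>\<mu>\<bar> \<le> \<bar>c\<bar>"
      using ab unfolding mem_W_unit_ball \<kappa> \<mu> by (simp_all only: modulus)
    with convex_combination_same_modulus[OF t c] have "\<kappa> = \<mu>" .
    then show False using \<open>a \<noteq> b\<close> unfolding \<kappa> \<mu> by blast
  qed
  then show ?thesis
    unfolding extreme_point_of_def e_def[symmetric] by (simp add: mem_W_unit_ball J one)
qed

end

section \<open>Characterisation of the extreme points\<close>

theorem theorem2p18:
  fixes \<epsilon> :: real and \<rho> :: "'a::euclidean_space \<Rightarrow> ennreal"
  assumes eps: "\<epsilon> > 0"
    and meas: "\<rho> \<in> borel_measurable lebesgue"
    and supp: "is_ess_support \<rho> (cball 0 \<epsilon>)"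
    and nontrivial: "W_space \<rho> \<noteq> {0}"
  shows "{u. u extreme_point_of (W_unit_ball \<rho>)} =
    {s *\<^sub>R abs_L1 (\<lambda>x. indicat_real E x / enn2real (perimeter \<rho> E)) | s E.
      s \<in> {1, -1} \<and> E \<in> sets lebesgue \<and>
      0 < emeasure lebesgue E \<and> emeasure lebesgue E < \<infinity> \<and>
      0 < perimeter \<rho> E \<and> perimeter \<rho> E < \<infinity> \<and>
      simple_set \<epsilon> \<rho> E}"
proof -
  interpret nonlocal_kernel \<epsilon> \<rho> using eps meas supp by unfold_locales
  have normalised: "s *\<^sub>R abs_L1 (\<lambda>x. indicat_real E x / P) = (s / P) *\<^sub>R abs_L1 (indicat_real E)"
    if "E \<in> sets lebesgue" "emeasure lebesgue E < \<infinity>" for s P and E :: "'a set"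
    using that by (simp add: scaleR_abs_L1)
  show ?thesis
  proof (intro equalityI subsetI)
    fix u assume "u \<in> {u. u extreme_point_of (W_unit_ball \<rho>)}"
    then have ext: "u extreme_point_of (W_unit_ball \<rho>)" by simp
    note one = extreme_seminorm_eq_1[OF ext nontrivial]
    obtain c E where c: "c \<noteq> 0" and E: "E \<in> sets borel" "0 < emeasure lborel E" "emeasure lborel E < \<infinity>"
      and u: "u = c *\<^sub>R abs_L1 (indicat_real E)"
      by (rule extreme_imp_indicator[OF ext one])
    have EL: "E \<in> sets lebesgue" "emeasure lebesgue E < \<infinity>" "0 < emeasure lebesgue E"
      using E by simp_all
    have simple: "simple_set \<epsilon> \<rho> E"
      unfolding simple_set_def
      using EL(2) extreme_imp_indecomposable[OF ext one EL(1,2) u c]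
        extreme_imp_no_finite_component[OF ext one E(1,3) u c] by auto
    then have "perimeter \<rho> E < \<infinity>" by (simp add: simple_set_def indecomposable_def)
    then obtain P where P: "perimeter \<rho> E = ennreal P" "0 \<le> P"
      by (cases "perimeter \<rho> E" rule: ennreal_cases) auto
    have "ennreal \<bar>c\<bar> * ennreal P = 1"
      using one by (simp add: u seminorm_scale perimeter_eq_seminorm[OF EL(1,2), symmetric] P)
    then have cP: "\<bar>c\<bar> * P = 1" using P(2) by (simp add: ennreal_mult'[symmetric])
    then have "P > 0" using P(2) by (cases "P = 0") auto
    have "c = sgn c / P"
    proof -
      have "\<bar>c\<bar> = 1 / P" using cP \<open>P > 0\<close> by (simp add: eq_divide_eq)
      then show ?thesis by (metis mult_sgn_abs times_divide_eq_right mult.right_neutral)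
    qed
    then have "u = sgn c *\<^sub>R abs_L1 (\<lambda>x. indicat_real E x / enn2real (perimeter \<rho> E))"
      using normalised[OF EL(1,2)] P by (simp add: u)
    moreover have "sgn c \<in> {1, -1}" using c by (auto simp: sgn_real_def)
    moreover have "0 < perimeter \<rho> E" "perimeter \<rho> E < \<infinity>" using P \<open>P > 0\<close> by simp_all
    ultimately show "u \<in> {s *\<^sub>R abs_L1 (\<lambda>x. indicat_real E x / enn2real (perimeter \<rho> E)) | s E.
      s \<in> {1, -1} \<and> E \<in> sets lebesgue \<and>
      0 < emeasure lebesgue E \<and> emeasure lebesgue E < \<infinity> \<and>
      0 < perimeter \<rho> E \<and> perimeter \<rho> E < \<infinity> \<and>
      simple_set \<epsilon> \<rho> E}"
      using EL simple by blast
  next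
    fix u assume "u \<in> {s *\<^sub>R abs_L1 (\<lambda>x. indicat_real E x / enn2real (perimeter \<rho> E)) | s E.
      s \<in> {1, -1} \<and> E \<in> sets lebesgue \<and>
      0 < emeasure lebesgue E \<and> emeasure lebesgue E < \<infinity> \<and>
      0 < perimeter \<rho> E \<and> perimeter \<rho> E < \<infinity> \<and>
      simple_set \<epsilon> \<rho> E}"
    then obtain s E where s: "s \<in> {1, -1}" and E: "E \<in> sets lebesgue" "emeasure lebesgue E < \<infinity>"
      and P: "0 < perimeter \<rho> E" "perimeter \<rho> E < \<infinity>" and simple: "simple_set \<epsilon> \<rho> E"
      and u: "u = s *\<^sub>R abs_L1 (\<lambda>x. indicat_real E x / enn2real (perimeter \<rho> E))"
      by blast
    obtain r where r: "perimeter \<rho> E = ennreal r" "0 < r"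
      using P by (cases "perimeter \<rho> E" rule: ennreal_cases) auto
    have "ennreal \<bar>s / r\<bar> * perimeter \<rho> E = 1"
      using s r by (auto simp: ennreal_mult'[symmetric])
    from simple_imp_extreme[OF E simple this]
    show "u \<in> {u. u extreme_point_of (W_unit_ball \<rho>)}"
      using r by (simp add: u normalised[OF E])
  qed
qed

end
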